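(* Let $X$ be a finite-dimensional compact Alexandrov space with curvature bounded below, and $Y$ a locally Lipschitz contractible metric space. Then every continuous map from $X$ to $Y$ is homotopic to a Lipschitz map.
   Context: Alexandrov spaces: a complete metric space $X$ is an Alexandrov space if it is a length space and for any $p\in X$ there exist $\kappa\in\mathbb R$ and a neighborhood $U$ of $p$ such that for any $x,y,z\in U\setminus\{p\}$ one has $\tilde\angle_\kappa xpy+\tilde\angle_\kappa ypz+\tilde\angle_\kappa zpx\le 2\pi$, where $\tilde\angle_\kappa xpy$ is the angle at $\tilde p$ of a comparison triangle $\Delta\tilde x\tilde p\tilde y$ in the complete simply connected surface of constant curvature $\kappa$. If $\kappa$ can be chosen independent of $p$, $X$ has curvature $\ge\kappa$ (curvature bounded below). The dimension is the Hausdorff dimension. Locally Lipschitz contractible: a metric space $Y$ is locally Lipschitz contractible if for every $p\in Y$ and $\epsilon>0$ there exist $r\in(0,\epsilon]$ and a Lipschitz map $\varphi:B(p,r)\times[0,1]\to B(p,\epsilon)$ with $\varphi(x,0)=x$ and $\varphi(x,1)=p$ for all $x\in B(p,r)$, where $B(p,r)$ is the open ball. *)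

theory Defs
  imports "HOL-Analysis.Analysis"
begin

text \<open>
  Metric spaces are rendered as subsets (with the induced metric) of a type of class
  \<^class>\<open>metric_space\<close>; taking the set to be the whole type gives the type itself.
\<close>

section \<open>Comparison angles in the model surfaces\<close>

text \<open>
  The complete simply connected surface of constant curvature \<open>k\<close>, realised in \<open>real ^ 3\<close> with
  the symmetric bilinear form \<open>model_form k\<close>: for \<open>k > 0\<close> the round sphere of radius
  \<open>1 / sqrt k\<close>, for \<open>k = 0\<close> a Euclidean plane, for \<open>k < 0\<close> the upper sheet of the
  hyperboloid in Minkowski space.
\<close>

definition model_form :: "real \<Rightarrow> real ^ 3 \<Rightarrow> real ^ 3 \<Rightarrow> real" where
  "model_form k u v = u $ 1 * v $ 1 + u $ 2 * v $ 2 + sgn k * (u $ 3 * v $ 3)"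

definition model_surface :: "real \<Rightarrow> (real ^ 3) set" where
  "model_surface k =
     (if k = 0 then {v. v $ 3 = 0}
      else {v. k * model_form k v v = 1 \<and> (k < 0 \<longrightarrow> v $ 3 > 0)})"

definition model_dist :: "real \<Rightarrow> real ^ 3 \<Rightarrow> real ^ 3 \<Rightarrow> real" where
  "model_dist k u v =
     (if k > 0 then arccos (k * model_form k u v) / sqrt k
      else if k < 0 then arcosh (k * model_form k u v) / sqrt (- k)
      else dist u v)"

text \<open>
  The form-orthogonal projection of \<open>a - q\<close> to the tangent plane at \<open>q\<close>; for \<open>a \<noteq> q\<close> (and \<open>a\<close>
  not antipodal to \<open>q\<close>) it is a positive multiple of the initial velocity of the minimal
  geodesic from \<open>q\<close> to \<open>a\<close>.
\<close>

definition model_direction :: "real \<Rightarrow> real ^ 3 \<Rightarrow> real ^ 3 \<Rightarrow> real ^ 3" where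
  "model_direction k q a = (a - q) - (k * model_form k (a - q) q) *\<^sub>R q"

definition model_angle :: "real \<Rightarrow> real ^ 3 \<Rightarrow> real ^ 3 \<Rightarrow> real ^ 3 \<Rightarrow> real" where
  "model_angle k a q b =
     (let u = model_direction k q a; v = model_direction k q b
      in arccos (model_form k u v / (sqrt (model_form k u u) * sqrt (model_form k v v))))"

definition comparison_triangle ::
  "real \<Rightarrow> 'a::metric_space \<Rightarrow> 'a \<Rightarrow> 'a \<Rightarrow> real ^ 3 \<Rightarrow> real ^ 3 \<Rightarrow> real ^ 3 \<Rightarrow> bool" where
  "comparison_triangle k x p y a q b \<longleftrightarrow>
     a \<in> model_surface k \<and> q \<in> model_surface k \<and> b \<in> model_surface k \<and>
     model_dist k a q = dist x p \<and> model_dist k q b = dist p y \<and> model_dist k a b = dist x y"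

definition comparison_angle :: "real \<Rightarrow> 'a::metric_space \<Rightarrow> 'a \<Rightarrow> 'a \<Rightarrow> real" where
  "comparison_angle k x p y =
     (THE t. \<exists>a q b. comparison_triangle k x p y a q b \<and> t = model_angle k a q b)"

text \<open>The description is proper: the angle does not depend on the choice of the triangle.\<close>

lemma model_form_cauchy_schwarz_neg:
  assumes "k < 0" "u \<in> model_surface k" "v \<in> model_surface k"
  shows "k * model_form k u v \<ge> 1"
proof -
  define r where "r = - 1 / k"
  have r: "r > 0" using assms(1) by (simp add: r_def)
  have u: "(u $ 3)\<^sup>2 = r + (u $ 1)\<^sup>2 + (u $ 2)\<^sup>2" "u $ 3 > 0"
    and v: "(v $ 3)\<^sup>2 = r + (v $ 1)\<^sup>2 + (v $ 2)\<^sup>2" "v $ 3 > 0"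
    using assms by (auto simp: model_surface_def model_form_def r_def field_simps power2_eq_square)
  have "(r + u $ 1 * v $ 1 + u $ 2 * v $ 2)\<^sup>2 \<le> (u $ 3 * v $ 3)\<^sup>2"
  proof -
    have "(u $ 3 * v $ 3)\<^sup>2 - (r + u $ 1 * v $ 1 + u $ 2 * v $ 2)\<^sup>2
        = r * (u $ 1 - v $ 1)\<^sup>2 + r * (u $ 2 - v $ 2)\<^sup>2 + (u $ 1 * v $ 2 - u $ 2 * v $ 1)\<^sup>2"
      unfolding power_mult_distrib u v by (simp add: power2_eq_square algebra_simps)
    also have "\<dots> \<ge> 0" using r by simp
    finally show ?thesis by simp
  qed
  moreover have "u $ 3 * v $ 3 \<ge> 0" using u v by simp
  ultimately have "r + u $ 1 * v $ 1 + u $ 2 * v $ 2 \<le> u $ 3 * v $ 3"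
    by (rule power2_le_imp_le)
  then have "model_form k u v \<le> - r" using assms(1) by (simp add: model_form_def)
  then have "k * (- r) \<le> k * model_form k u v"
    using assms(1) by (intro mult_left_mono_neg) auto
  then show ?thesis using assms(1) by (simp add: r_def)
qed

lemma model_form_cauchy_schwarz_pos:
  assumes "k > 0" "u \<in> model_surface k" "v \<in> model_surface k"
  shows "\<bar>k * model_form k u v\<bar> \<le> 1"
proof -
  have form: "model_form k w z = inner w z" for w z
    using assms(1) by (simp add: model_form_def inner_vec_def sum_3)
  have n: "(norm w)\<^sup>2 = 1 / k" if "w \<in> model_surface k" for w
    using that assms(1)
    by (simp add: model_surface_def form power2_norm_eq_inner field_simps)
  have "norm u = norm v" using n[OF assms(2)] n[OF assms(3)]
    by (metis norm_ge_zero power2_eq_iff_nonneg)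
  then have "norm u * norm v = 1 / k" using n[OF assms(2)] by (simp add: power2_eq_square)
  then have "\<bar>model_form k u v\<bar> \<le> 1 / k"
    using Cauchy_Schwarz_ineq2[of u v] by (simp add: form)
  then show ?thesis using assms(1) by (simp add: abs_mult field_simps)
qed

lemma model_dist_eqD:
  assumes "k \<noteq> 0" "a \<in> model_surface k" "b \<in> model_surface k"
    "a' \<in> model_surface k" "b' \<in> model_surface k" "model_dist k a b = model_dist k a' b'"
  shows "model_form k a b = model_form k a' b'"
proof (cases "k > 0")
  case True
  then have "arccos (k * model_form k a b) = arccos (k * model_form k a' b')"
    using assms(6) by (simp add: model_dist_def)
  then show ?thesis
    using model_form_cauchy_schwarz_pos True assms arccos_eq_iff by fastforce
next
  case False
  then have k: "k < 0" using assms(1) by simp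
  then have "arcosh (k * model_form k a b) = arcosh (k * model_form k a' b')"
    using assms(6) by (simp add: model_dist_def)
  then have "k * model_form k a b = k * model_form k a' b'"
    by (metis k assms(2-5) model_form_cauchy_schwarz_neg cosh_arcosh_real)
  then show ?thesis using assms(1) by simp
qed

lemma model_form_direction:
  assumes "q \<in> model_surface k" "k \<noteq> 0"
  shows "model_form k (model_direction k q a) (model_direction k q b)
       = model_form k a b - k * model_form k a q * model_form k q b"
proof -
  have bilin: "model_form k (w - c *\<^sub>R z) x = model_form k w x - c * model_form k z x"
    "model_form k w (x - c *\<^sub>R z) = model_form k w x - c * model_form k w z"
    "model_form k (w - z) x = model_form k w x - model_form k z x"
    "model_form k w x = model_form k x w" for w z x c
    by (simp_all add: model_form_def algebra_simps)
  have q: "k * model_form k q q = 1" using assms by (simp add: model_surface_def)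
  have dir: "model_direction k q c = c - (k * model_form k c q) *\<^sub>R q" for c
    using q by (simp add: model_direction_def bilin(3) algebra_simps)
  have "model_form k (model_direction k q a) (model_direction k q b)
      = model_form k a b - k * model_form k b q * model_form k a q
        - k * model_form k a q * (model_form k q b - model_form k b q * (k * model_form k q q))"
    by (simp add: dir bilin(1,2) algebra_simps)
  then show ?thesis by (simp add: q bilin(4)[of b q])
qed

lemma model_angle_unique:
  fixes x p y :: "'a::metric_space"
  assumes "comparison_triangle k x p y a q b" "comparison_triangle k x p y a' q' b'"
  shows "model_angle k a q b = model_angle k a' q' b'"
proof (cases "k = 0")
  case True
  have flat: "model_form 0 w z = inner w z" if "w $ 3 = 0" for w z :: "real ^ 3"
    using that by (simp add: model_form_def inner_vec_def sum_3)
  have ang: "model_angle 0 c r d =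
      arccos (((dist c r)\<^sup>2 + (dist r d)\<^sup>2 - (dist c d)\<^sup>2) / 2 / (dist c r * dist r d))"
    if "c $ 3 = 0" "r $ 3 = 0" "d $ 3 = 0" for c r d :: "real ^ 3"
  proof -
    have "model_angle 0 c r d = arccos (inner (c - r) (d - r) / (dist c r * dist r d))"
      using that
      by (simp add: model_angle_def model_direction_def flat dist_norm norm_minus_commute Let_def
          flip: norm_eq_sqrt_inner)
    moreover have "inner (c - r) (d - r) = ((dist c r)\<^sup>2 + (dist r d)\<^sup>2 - (dist c d)\<^sup>2) / 2"
      by (simp add: dist_norm power2_norm_eq_inner inner_diff inner_commute algebra_simps)
    ultimately show ?thesis by simp
  qed
  show ?thesis
    using assms ang[of a q b] ang[of a' q' b']
    by (simp add: comparison_triangle_def model_surface_def model_dist_def True)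
next
  case False
  have surf: "a \<in> model_surface k" "q \<in> model_surface k" "b \<in> model_surface k"
    "a' \<in> model_surface k" "q' \<in> model_surface k" "b' \<in> model_surface k"
    using assms by (simp_all add: comparison_triangle_def)
  have self: "model_form k w w = 1 / k" if "w \<in> model_surface k" for w
    using that False by (simp add: model_surface_def field_simps)
  have comm: "model_form k w z = model_form k z w" for w z
    by (simp add: model_form_def algebra_simps)
  have eq: "model_form k a q = model_form k a' q'" "model_form k q b = model_form k q' b'"
    "model_form k a b = model_form k a' b'"
    using assms False by (auto intro!: model_dist_eqD simp: comparison_triangle_def)
  show ?thesis
    using eq surf False comm[of q a] comm[of q' a'] comm[of b q] comm[of b' q']
    by (simp add: model_angle_def model_form_direction self)
qed

lemma comparison_angle_eq:
  fixes x p y :: "'a::metric_space"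
  assumes "comparison_triangle k x p y a q b"
  shows "comparison_angle k x p y = model_angle k a q b"
  unfolding comparison_angle_def
  by (rule the_equality) (use assms model_angle_unique in blast)+


section \<open>Alexandrov spaces\<close>

definition curve_length :: "(real \<Rightarrow> 'a::metric_space) \<Rightarrow> ennreal" where
  "curve_length g =
     (SUP ts \<in> {ts. sorted ts \<and> set ts \<subseteq> {0..1}}.
        \<Sum>i < length ts - 1. ennreal (dist (g (ts ! i)) (g (ts ! Suc i))))"

definition length_space :: "'a::metric_space set \<Rightarrow> bool" where
  "length_space X \<longleftrightarrow>
     (\<forall>x\<in>X. \<forall>y\<in>X. ennreal (dist x y) =
        Inf {curve_length g | g.
               path g \<and> path_image g \<subseteq> X \<and> pathstart g = x \<and> pathfinish g = y})"

text \<open>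
  For \<open>k > 0\<close> comparison triangles exist only for small triangles. This is harmless: the
  condition passes to smaller neighbourhoods \<open>U\<close>, so \<open>U\<close> may always be taken so small that all
  comparison angles involved are defined.
\<close>

definition curvature_ge_near :: "real \<Rightarrow> 'a::metric_space set \<Rightarrow> 'a \<Rightarrow> bool" where
  "curvature_ge_near k X p \<longleftrightarrow>
     (\<exists>U. openin (top_of_set X) U \<and> p \<in> U \<and>
        (\<forall>x\<in>U - {p}. \<forall>y\<in>U - {p}. \<forall>z\<in>U - {p}.
           comparison_angle k x p y + comparison_angle k y p z + comparison_angle k z p x
             \<le> 2 * pi))"

definition alexandrov_space :: "'a::metric_space set \<Rightarrow> bool" where
  "alexandrov_space X \<longleftrightarrow>
     complete X \<and> length_space X \<and> (\<forall>p\<in>X. \<exists>k. curvature_ge_near k X p)"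

definition curvature_bounded_below :: "'a::metric_space set \<Rightarrow> bool" where
  "curvature_bounded_below X \<longleftrightarrow> (\<exists>k. \<forall>p\<in>X. curvature_ge_near k X p)"


section \<open>Hausdorff dimension\<close>

text \<open>
  The Hausdorff measure is left unnormalised and is used only for \<open>s > 0\<close>
  (recall that \<open>0 powr 0 = 0\<close>).
\<close>

definition hausdorff_premeasure :: "real \<Rightarrow> real \<Rightarrow> 'a::metric_space set \<Rightarrow> ennreal" where
  "hausdorff_premeasure s \<delta> A =
     Inf {\<Sum>n. ennreal (diameter (C n) powr s) | C :: nat \<Rightarrow> 'a set.
            A \<subseteq> (\<Union>n. C n) \<and> (\<forall>n. bounded (C n) \<and> diameter (C n) \<le> \<delta>)}"

definition hausdorff_measure :: "real \<Rightarrow> 'a::metric_space set \<Rightarrow> ennreal" where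
  "hausdorff_measure s A = (SUP \<delta> \<in> {0<..}. hausdorff_premeasure s \<delta> A)"

definition hausdorff_dim :: "'a::metric_space set \<Rightarrow> ennreal" where
  "hausdorff_dim A = Inf {ennreal s | s. s > 0 \<and> hausdorff_measure s A = 0}"


section \<open>Locally Lipschitz contractible spaces\<close>

definition locally_lipschitz_contractible :: "'a::metric_space set \<Rightarrow> bool" where
  "locally_lipschitz_contractible Y \<longleftrightarrow>
     (\<forall>p\<in>Y. \<forall>\<epsilon>>0. \<exists>r\<in>{0<..\<epsilon>}. \<exists>(\<phi> :: 'a \<times> real \<Rightarrow> 'a) L.
        L-lipschitz_on ((ball p r \<inter> Y) \<times> {0..1}) \<phi> \<and>
        \<phi> ` ((ball p r \<inter> Y) \<times> {0..1}) \<subseteq> ball p \<epsilon> \<inter> Y \<and>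
        (\<forall>x\<in>ball p r \<inter> Y. \<phi> (x, 0) = x \<and> \<phi> (x, 1) = p))"

end

theory Submission
  imports Defs
begin

text \<open>
  The idea is to build maps on \<open>X\<close> piece by piece, where two overlapping pieces are reconciled by a
  Lipschitz contraction of a small ball of \<open>Y\<close>. Every such repair enlarges the error by an amount
  controlled by \<open>Y\<close> and the compact set \<open>f ` X\<close> alone, so the method needs a bound on the number of repairs that does
  not depend on the scale. Such a bound comes from the finite dimension of \<open>X\<close>.

  Finite Hausdorff dimension gives an \<open>n\<close> such that \<open>X\<close> has vanishing
  \<open>n\<close>-dimensional content (\<open>null_content\<close>). Almost every sphere around a given centre meets such a
  set in a set of vanishing \<open>(n - 1)\<close>-dimensional content (\<open>null_content_sphere\<close>). Covering \<open>X\<close> by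
  small balls with good radii, the pieces cut out by the spheres are disjoint small open sets,
  and the spheres themselves are handled by induction. Hence \<open>X\<close> has, at every scale, a finite open
  cover by \<open>n\<close> families of pairwise disjoint small sets (\<open>coloured_cover\<close>); a family is called a
  colour.

  Suppose a Lipschitz map close to a target map \<open>F\<close> is given on the part of the domain treated so far.
  On a set of the next colour, \<open>F\<close> is nearly constant, so the map takes values in a small ball there,
  and moving these values along the contraction of that ball while leaving the old part turns
  the map into a constant, which extends. Since the sets of one colour are disjoint, they can be
  treated simultaneously (\<open>lipschitz_extend_one_colour\<close>); \<open>n\<close> rounds treat everything
  (\<open>lipschitz_extend_colours\<close>).

  Starting from the empty map, this gives a Lipschitz map \<open>g\<close> uniformly close to \<open>f\<close>. The
  homotopy is obtained from the same extension result on \<open>X \<times> {0..1}\<close>, starting from \<open>f\<close> near time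
  \<open>0\<close> and from \<open>g\<close> near time \<open>1\<close>. To remain with Lipschitz maps although \<open>f\<close> is only
  continuous, \<open>X\<close> is replaced by the graph of \<open>f\<close>, on which \<open>f\<close> becomes a projection; the colours
  of \<open>X\<close> can be used unchanged because on their pieces \<open>f\<close> is nearly constant.
\<close>

section \<open>Vanishing Hausdorff content\<close>

text \<open>
  Vanishing \<open>n\<close>-dimensional Hausdorff content, with finite covers. For compact sets and \<open>n > 0\<close> this
  agrees with vanishing Hausdorff measure. Requiring finite covers by balls of positive radius
  makes the case \<open>n = 0\<close> say that the set is empty, because \<open>r ^ 0 = 1\<close>.
\<close>

definition null_content :: "nat \<Rightarrow> 'a::metric_space set \<Rightarrow> bool" where
  "null_content n K \<longleftrightarrow>
     (\<forall>e>0. \<exists>B. finite B \<and> (\<forall>b\<in>B. 0 < snd b) \<and> K \<subseteq> (\<Union>b\<in>B. ball (fst b) (snd b)) \<and>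
        (\<Sum>b\<in>B. snd b ^ n) < e)"

lemma null_contentE:
  assumes "null_content n K" "e > 0"
  obtains B where "finite B" "\<And>b. b \<in> B \<Longrightarrow> 0 < snd b" "K \<subseteq> (\<Union>b\<in>B. ball (fst b) (snd b))"
    "(\<Sum>b\<in>B. snd b ^ n) < e"
proof -
  from assms have "\<exists>B. finite B \<and> (\<forall>b\<in>B. 0 < snd b) \<and> K \<subseteq> (\<Union>b\<in>B. ball (fst b) (snd b)) \<and>
      (\<Sum>b\<in>B. snd b ^ n) < e"
    unfolding null_content_def by simp
  then show ?thesis using that by auto
qed

lemma null_content_0_empty:
  assumes "null_content 0 K"
  shows "K = {}"
proof -
  obtain B where "finite B" "K \<subseteq> (\<Union>b\<in>B. ball (fst b) (snd b))" "(\<Sum>b\<in>B. snd b ^ 0) < 1"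
    using null_contentE[OF assms, of 1] by auto
  then show ?thesis by auto
qed

lemma null_content_empty: "null_content n {}"
  unfolding null_content_def by (intro allI impI exI[of _ "{}"]) auto

lemma null_content_Un:
  assumes "null_content n K" "null_content n K'"
  shows "null_content n (K \<union> K')"
  unfolding null_content_def
proof (intro allI impI)
  fix e :: real assume "e > 0"
  then have e: "e / 2 > 0" by simp
  obtain B where B: "finite B" "\<And>b. b \<in> B \<Longrightarrow> 0 < snd b" "K \<subseteq> (\<Union>b\<in>B. ball (fst b) (snd b))"
    "(\<Sum>b\<in>B. snd b ^ n) < e / 2"
    using null_contentE[OF assms(1) e] by blast
  obtain B' where B': "finite B'" "\<And>b. b \<in> B' \<Longrightarrow> 0 < snd b"
    "K' \<subseteq> (\<Union>b\<in>B'. ball (fst b) (snd b))" "(\<Sum>b\<in>B'. snd b ^ n) < e / 2"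
    using null_contentE[OF assms(2) e] by blast
  have "(\<Sum>b\<in>B \<union> B'. snd b ^ n) + (\<Sum>b\<in>B \<inter> B'. snd b ^ n) =
        (\<Sum>b\<in>B. snd b ^ n) + (\<Sum>b\<in>B'. snd b ^ n)"
    using B(1) B'(1) by (rule sum.union_inter)
  moreover have "(\<Sum>b\<in>B \<inter> B'. snd b ^ n) \<ge> 0"
    using B(2) by (intro sum_nonneg) (auto intro: less_imp_le)
  ultimately have "(\<Sum>b\<in>B \<union> B'. snd b ^ n) < e" using B(4) B'(4) by linarith
  then show "\<exists>C. finite C \<and> (\<forall>b\<in>C. 0 < snd b) \<and>
      K \<union> K' \<subseteq> (\<Union>b\<in>C. ball (fst b) (snd b)) \<and> (\<Sum>b\<in>C. snd b ^ n) < e"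
    using B(1-3) B'(1-3) by (intro exI[of _ "B \<union> B'"]) auto
qed

lemma null_content_UN:
  assumes "finite I" "\<And>i. i \<in> I \<Longrightarrow> null_content n (K i)"
  shows "null_content n (\<Union>i\<in>I. K i)"
  using assms by (induction I rule: finite_induct) (auto intro: null_content_empty null_content_Un)

text \<open>
  This is Eilenberg's inequality in the form needed here. A ball of radius \<open>r\<close> meets only those
  spheres around \<open>x\<close> whose radius lies in an interval of length \<open>2 * r\<close>. Hence, for a cover of \<open>K\<close>, the
  sum of \<open>r ^ n\<close> over the balls that meet the sphere of radius \<open>t\<close> has an integral over \<open>t\<close> of at most
  twice the sum of \<open>r ^ Suc n\<close>. For a sequence of covers for which the latter sums are summable, the
  former sums tend to \<open>0\<close> for almost every \<open>t\<close>.
\<close>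

lemma null_content_sphere:
  fixes K :: "'a::metric_space set"
  assumes K: "null_content (Suc n) K" and "a < b"
  shows "\<exists>t\<in>{a<..<b}. null_content n (K \<inter> sphere x t)"
proof -
  define Q where "Q k B \<longleftrightarrow> finite B \<and> (\<forall>b\<in>B. 0 < snd b) \<and> K \<subseteq> (\<Union>b\<in>B. ball (fst b) (snd b)) \<and>
      (\<Sum>b\<in>B. snd b ^ Suc n) < (1/2)^k" for k :: nat and B :: "('a \<times> real) set"
  have "\<exists>B. Q k B" for k
    using K unfolding null_content_def Q_def by simp
  then obtain B where Q: "\<And>k. Q k (B k)" by metis
  have fin: "\<And>k. finite (B k)" and pos: "\<And>k b. b \<in> B k \<Longrightarrow> 0 < snd b" and
    cov: "\<And>k. K \<subseteq> (\<Union>b\<in>B k. ball (fst b) (snd b))" and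
    small: "\<And>k. (\<Sum>b\<in>B k. snd b ^ Suc n) < (1/2)^k"
    using Q unfolding Q_def by auto
  \<comment> \<open>The radii of spheres around \<open>x\<close> that a ball can meet, and the \<open>n\<close>-dimensional content of the
    part of the cover \<open>B k\<close> that is needed for the sphere of radius \<open>t\<close>.\<close>
  define J where "J b = {dist x (fst b) - snd b..dist x (fst b) + snd b}" for b :: "'a \<times> real"
  define G where "G k t = (\<Sum>b\<in>B k. snd b ^ n * indicat_real (J b) t)" for k t
  have G0: "G k t \<ge> 0" for k t
    unfolding G_def using pos by (intro sum_nonneg mult_nonneg_nonneg) (auto intro: less_imp_le)
  have meas[measurable]: "J b \<in> sets borel" for b unfolding J_def by simp
  have eG: "ennreal (G k t) = (\<Sum>b\<in>B k. ennreal (snd b ^ n) * indicator (J b) t)" for k t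
    unfolding G_def
    by (subst sum_ennreal[symmetric])
       (use pos in \<open>auto intro: less_imp_le simp: indicator_def intro!: sum.cong\<close>)
  have mG[measurable]: "(\<lambda>t. ennreal (G k t)) \<in> borel_measurable lborel" for k
    unfolding eG by measurable
  have int: "(\<integral>\<^sup>+t. ennreal (G k t) \<partial>lborel) \<le> ennreal (2 * (1/2)^k)" for k
  proof -
    have "(\<integral>\<^sup>+t. ennreal (G k t) \<partial>lborel) = (\<Sum>b\<in>B k. ennreal (snd b ^ n) * emeasure lborel (J b))"
      unfolding eG by (subst nn_integral_sum) (auto simp: nn_integral_cmult_indicator)
    also have "\<dots> = (\<Sum>b\<in>B k. ennreal (2 * snd b ^ Suc n))"
      using pos by (intro sum.cong refl)
        (auto simp: J_def less_imp_le simp flip: ennreal_mult' intro!: arg_cong[where f=ennreal])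
    also have "\<dots> = ennreal (2 * (\<Sum>b\<in>B k. snd b ^ Suc n))"
      using pos by (subst sum_ennreal) (auto simp: sum_distrib_left intro: less_imp_le)
    also have "\<dots> \<le> ennreal (2 * (1/2)^k)"
      using small[of k] by (intro ennreal_leI) simp
    finally show ?thesis .
  qed
  have "(\<integral>\<^sup>+t. (\<Sum>k. ennreal (G k t)) \<partial>lborel) = (\<Sum>k. \<integral>\<^sup>+t. ennreal (G k t) \<partial>lborel)"
    by (rule nn_integral_suminf) simp
  also have "\<dots> \<le> (\<Sum>k. ennreal (2 * (1/2)^k))"
    using int by (intro suminf_le) auto
  also have "\<dots> = ennreal (\<Sum>k. 2 * (1/2)^k)"
    by (intro suminf_ennreal2) auto
  also have "\<dots> < \<infinity>" by simp
  finally have "AE t in lborel. (\<Sum>k. ennreal (G k t)) \<noteq> \<infinity>"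
    by (intro nn_integral_noteq_infinite) auto
  then obtain N where N: "N \<in> null_sets lborel" "{t. (\<Sum>k. ennreal (G k t)) = \<infinity>} \<subseteq> N"
    by (elim AE_E3) auto
  have "\<not> {a<..<b} \<subseteq> N"
    using N(1) \<open>a < b\<close> null_sets_subset[of N lborel "{a<..<b}"] by (auto simp: null_sets_def)
  then obtain t where t: "t \<in> {a<..<b}" "(\<Sum>k. ennreal (G k t)) \<noteq> \<infinity>" using N(2) by blast
  have "(\<lambda>k. G k t) \<longlonglongrightarrow> 0"
    using t(2) G0 by (intro summable_LIMSEQ_zero summable_suminf_not_top) auto
  have "null_content n (K \<inter> sphere x t)"
    unfolding null_content_def
  proof (intro allI impI)
    fix e :: real assume "e > 0"
    then have "eventually (\<lambda>k. G k t < e) sequentially"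
      using \<open>(\<lambda>k. G k t) \<longlonglongrightarrow> 0\<close> by (rule order_tendstoD(2)[rotated])
    then obtain k where k: "G k t < e" by (auto simp: eventually_sequentially)
    define B' where "B' = {b \<in> B k. t \<in> J b}"
    have "(\<Sum>b\<in>B'. snd b ^ n) = G k t"
      unfolding G_def B'_def sum.inter_filter[OF fin] by (auto simp: indicator_def intro!: sum.cong)
    moreover have "K \<inter> sphere x t \<subseteq> (\<Union>b\<in>B'. ball (fst b) (snd b))"
    proof
      fix y assume y: "y \<in> K \<inter> sphere x t"
      then obtain b where b: "b \<in> B k" "y \<in> ball (fst b) (snd b)" using cov by blast
      have "dist x (fst b) \<le> dist x y + dist y (fst b)" "dist x y \<le> dist x (fst b) + dist (fst b) y"
        by (rule dist_triangle)+
      then have "t \<in> J b" using y b by (auto simp: J_def dist_commute)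
      then have "b \<in> B'" using b by (simp add: B'_def)
      then show "y \<in> (\<Union>b\<in>B'. ball (fst b) (snd b))" using b(2) by (rule UN_I)
    qed
    ultimately show "\<exists>C. finite C \<and> (\<forall>b\<in>C. 0 < snd b) \<and>
        K \<inter> sphere x t \<subseteq> (\<Union>b\<in>C. ball (fst b) (snd b)) \<and> (\<Sum>b\<in>C. snd b ^ n) < e"
      using k fin pos by (intro exI[of _ B']) (auto simp: B'_def)
  qed
  with t show ?thesis by blast
qed

text \<open>
  A cover by sets of diameter at most \<open>1\<close> with small sum of \<open>s\<close>-th powers has small sum of \<open>n\<close>-th
  powers for any integer \<open>n \<ge> s\<close>. Each covering set is enlarged to a ball of slightly larger
  radius; these balls are open, so compactness leaves finitely many of them.
\<close>

lemma null_content_if_hausdorff_dim_finite: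
  fixes X :: "'a::metric_space set"
  assumes "compact X" "hausdorff_dim X < \<infinity>"
  obtains n where "null_content n X"
proof -
  from assms(2) obtain s where s: "s > 0" "hausdorff_measure s X = 0"
    unfolding hausdorff_dim_def by (auto simp: Inf_less_iff)
  then have pre: "hausdorff_premeasure s 1 X = 0"
    unfolding hausdorff_measure_def
    by (metis SUP_upper greaterThan_iff le_zero_eq zero_less_one)
  define n where "n = nat \<lceil>s\<rceil>"
  have n: "real n \<ge> s" "n > 0" using s(1) by (auto simp: n_def)
  have "null_content n X"
    unfolding null_content_def
  proof (intro allI impI)
    fix e :: real assume e: "e > 0"
    then have "hausdorff_premeasure s 1 X < ennreal (e / 2)" using pre by simp
    then obtain C :: "nat \<Rightarrow> 'a set" where C: "X \<subseteq> (\<Union>k. C k)" "\<And>k. bounded (C k)"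
      "\<And>k. diameter (C k) \<le> 1" "(\<Sum>k. ennreal (diameter (C k) powr s)) < ennreal (e / 2)"
      unfolding hausdorff_premeasure_def by (auto simp: Inf_less_iff)
    \<comment> \<open>The radius exceeds the diameter so that the ball around any point of the set contains the
      set; the summable error term absorbs the excess.\<close>
    have "\<exists>r. r > diameter (C k) \<and> r ^ n < diameter (C k) powr s + e / 2 * (1/2) ^ Suc k" for k
    proof -
      define d where "d = diameter (C k)"
      have d: "0 \<le> d" "d \<le> 1" using C by (auto simp: d_def diameter_ge_0)
      have "d ^ n \<le> d powr s"
      proof (cases "d = 0")
        case False
        then have "d ^ n = d powr real n" using d by (simp add: powr_realpow)
        also have "\<dots> \<le> d powr s" using d n False by (intro powr_mono') auto
        finally show ?thesis .
      qed (use n in \<open>auto simp: power_0_left\<close>)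
      also have "\<dots> < d powr s + e / 2 * (1/2) ^ Suc k" using e by simp
      finally have "eventually (\<lambda>r. r ^ n < d powr s + e / 2 * (1/2) ^ Suc k) (at_right d)"
        by (intro order_tendstoD(2)[of "\<lambda>r. r ^ n" "d ^ n"]) (auto intro!: tendsto_eq_intros)
      moreover have "eventually (\<lambda>r. r > d) (at_right d)"
        by (simp add: eventually_at_filter)
      ultimately have "eventually (\<lambda>r. r > d \<and> r ^ n < d powr s + e / 2 * (1/2) ^ Suc k) (at_right d)"
        by eventually_elim auto
      then show ?thesis unfolding d_def[symmetric]
        using eventually_happens'[OF trivial_limit_at_right_real] by blast
    qed
    then obtain r where r: "\<And>k. r k > diameter (C k)"
      "\<And>k. r k ^ n < diameter (C k) powr s + e / 2 * (1/2) ^ Suc k" by metis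
    define c where "c k = (SOME z. z \<in> C k)" for k
    have Cr: "C k \<subseteq> ball (c k) (r k)" for k
    proof
      fix z assume z: "z \<in> C k"
      then have "c k \<in> C k" unfolding c_def by (rule someI)
      then have "dist (c k) z \<le> diameter (C k)" using z C(2) by (intro diameter_bounded_bound)
      with r(1)[of k] show "z \<in> ball (c k) (r k)" by simp
    qed
    have "X \<subseteq> (\<Union>k\<in>UNIV. ball (c k) (r k))" using C(1) Cr by blast
    then obtain I where I: "finite I" "X \<subseteq> (\<Union>k\<in>I. ball (c k) (r k))"
      by (rule compactE_image[OF assms(1) open_ball])
    have rpos: "r k > 0" for k using r(1)[of k] diameter_ge_0[OF C(2), of k] by linarith
    have "(\<Sum>b\<in>(\<lambda>k. (c k, r k)) ` I. snd b ^ n) \<le> (\<Sum>k\<in>I. r k ^ n)"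
      using sum_image_le[OF I(1), of "\<lambda>b. snd b ^ n" "\<lambda>k. (c k, r k)"] rpos
      by (simp add: less_imp_le)
    also have "\<dots> \<le> (\<Sum>k\<in>I. diameter (C k) powr s + e / 2 * (1/2) ^ Suc k)"
      using r(2) by (intro sum_mono less_imp_le)
    also have "\<dots> = (\<Sum>k\<in>I. diameter (C k) powr s) + e / 2 * (\<Sum>k\<in>I. (1/2) ^ Suc k)"
      by (simp add: sum.distrib sum_distrib_left)
    also have "\<dots> < e"
    proof -
      have "ennreal (\<Sum>k\<in>I. diameter (C k) powr s) = (\<Sum>k\<in>I. ennreal (diameter (C k) powr s))"
        by (simp add: sum_ennreal)
      also have "\<dots> \<le> (\<Sum>k. ennreal (diameter (C k) powr s))"
        using I(1) by (intro sum_le_suminf) auto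
      also note C(4)
      finally have "(\<Sum>k\<in>I. diameter (C k) powr s) < e / 2"
        by (subst (asm) ennreal_less_iff) (auto intro: sum_nonneg)
      moreover have "(\<Sum>k\<in>I. (1/2::real) ^ Suc k) \<le> 1"
        using sum_le_suminf[OF sums_summable[OF power_half_series] I(1)]
          sums_unique[OF power_half_series] by simp
      then have "e / 2 * (\<Sum>k\<in>I. (1/2) ^ Suc k) \<le> e / 2 * 1"
        using e by (intro mult_left_mono) auto
      ultimately show ?thesis by linarith
    qed
    finally show "\<exists>B. finite B \<and> (\<forall>b\<in>B. 0 < snd b) \<and> X \<subseteq> (\<Union>b\<in>B. ball (fst b) (snd b)) \<and>
        (\<Sum>b\<in>B. snd b ^ n) < e"
      using I rpos by (intro exI[of _ "(\<lambda>k. (c k, r k)) ` I"]) auto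
  qed
  then show ?thesis by (rule that)
qed

section \<open>Coloured covers\<close>

text \<open>
  Finite Hausdorff dimension bounds the covering dimension. Radii for which the spheres have
  vanishing \<open>n\<close>-dimensional content are chosen for a cover of \<open>K\<close> by small balls. The points on none
  of the spheres are sorted by the set \<open>\<sigma>\<close> of balls that contain them: the resulting sets are open
  and disjoint, and they are small since \<open>\<sigma>\<close> is nonempty. They form the new colour, while the union of
  the spheres is covered with \<open>n\<close> colours by the induction hypothesis. The induction ends because
  \<open>null_content 0\<close> forces emptiness.
\<close>

lemma coloured_cover:
  fixes K :: "'a::metric_space set"
  assumes "null_content n K" "\<epsilon> > 0"
  shows "\<exists>U :: nat \<Rightarrow> 'a set set.
     (\<forall>i<n. finite (U i) \<and> pairwise disjnt (U i) \<and>
        (\<forall>V\<in>U i. open V \<and> (\<forall>x\<in>V. \<forall>y\<in>V. dist x y < \<epsilon>))) \<and> K \<subseteq> (\<Union>i<n. \<Union>(U i))"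
  using assms(1)
proof (induction n arbitrary: K)
  case 0
  then show ?case using null_content_0_empty by auto
next
  case (Suc n)
  have "(\<epsilon> / 4) ^ Suc n > 0" using assms(2) by simp
  then obtain B where B: "finite B" "\<And>b. b \<in> B \<Longrightarrow> 0 < snd b" "K \<subseteq> (\<Union>b\<in>B. ball (fst b) (snd b))"
    "(\<Sum>b\<in>B. snd b ^ Suc n) < (\<epsilon> / 4) ^ Suc n"
    by (rule null_contentE[OF Suc.prems]) blast
  \<comment> \<open>A single ball already contributes its radius to the power \<open>Suc n\<close>, so all radii are small.\<close>
  have small: "snd b < \<epsilon> / 4" if "b \<in> B" for b
  proof -
    have "snd b ^ Suc n \<le> (\<Sum>b\<in>B. snd b ^ Suc n)"
      using B(1,2) that by (intro member_le_sum) (auto intro: less_imp_le)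
    also note B(4)
    finally show ?thesis
      using power_less_imp_less_base[of "snd b" "Suc n" "\<epsilon> / 4"] assms(2) by simp
  qed
  have "\<forall>b\<in>B. \<exists>t\<in>{snd b<..<\<epsilon>/2}. null_content n (K \<inter> sphere (fst b) t)"
    using small assms(2) by (intro ballI null_content_sphere[OF Suc.prems]) fastforce
  then obtain t where t: "\<And>b. b \<in> B \<Longrightarrow> snd b < t b \<and> t b < \<epsilon> / 2 \<and>
      null_content n (K \<inter> sphere (fst b) (t b))"
    by (metis greaterThanLessThan_iff)
  define S where "S = (\<Union>b\<in>B. K \<inter> sphere (fst b) (t b))"
  have "null_content n S" unfolding S_def using B(1) t by (intro null_content_UN) auto
  then have "\<exists>U :: nat \<Rightarrow> 'a set set. (\<forall>i<n. finite (U i) \<and> pairwise disjnt (U i) \<and>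
        (\<forall>V\<in>U i. open V \<and> (\<forall>x\<in>V. \<forall>y\<in>V. dist x y < \<epsilon>))) \<and> S \<subseteq> (\<Union>i<n. \<Union>(U i))"
    by (rule Suc.IH)
  then obtain U :: "nat \<Rightarrow> 'a set set" where U: "\<forall>i<n. finite (U i) \<and> pairwise disjnt (U i) \<and>
        (\<forall>V\<in>U i. open V \<and> (\<forall>x\<in>V. \<forall>y\<in>V. dist x y < \<epsilon>))" "S \<subseteq> (\<Union>i<n. \<Union>(U i))"
    by (elim exE conjE) (rule that)
  define P where "P \<sigma> = (\<Inter>b\<in>\<sigma>. {z. dist (fst b) z < t b}) \<inter>
      (\<Inter>b\<in>B - \<sigma>. {z. dist (fst b) z > t b})" for \<sigma>
  define W where "W = P ` (Pow B - {{}})"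
  have "finite W" unfolding W_def using B(1) by simp
  moreover have "pairwise disjnt W"
  proof (rule pairwiseI)
    fix V V' assume "V \<in> W" "V' \<in> W" "V \<noteq> V'"
    then obtain \<sigma> \<sigma>' where \<sigma>: "V = P \<sigma>" "V' = P \<sigma>'" "\<sigma> \<subseteq> B" "\<sigma>' \<subseteq> B" "\<sigma> \<noteq> \<sigma>'"
      unfolding W_def by blast
    then obtain b where "b \<in> \<sigma> \<and> b \<in> B - \<sigma>' \<or> b \<in> \<sigma>' \<and> b \<in> B - \<sigma>" by blast
    then have "z \<notin> V \<or> z \<notin> V'" for z
      unfolding \<sigma>(1,2) P_def using less_asym by fastforce
    then show "disjnt V V'" unfolding disjnt_iff by blast
  qed
  moreover have "open V" if V: "V \<in> W" for V
  proof -
    obtain \<sigma> where \<sigma>: "V = P \<sigma>" "\<sigma> \<subseteq> B" using V unfolding W_def by blast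
    then have "finite \<sigma>" using B(1) finite_subset by blast
    then show ?thesis unfolding \<sigma>(1) P_def using B(1)
      by (intro open_Int open_INT ballI open_Collect_less continuous_intros) auto
  qed
  moreover have "dist x y < \<epsilon>" if V: "V \<in> W" and "x \<in> V" "y \<in> V" for V x y
  proof -
    obtain \<sigma> b where \<sigma>: "V = P \<sigma>" "\<sigma> \<subseteq> B" "b \<in> \<sigma>" using V unfolding W_def by blast
    then have "dist (fst b) x < t b" "dist (fst b) y < t b" "t b < \<epsilon> / 2"
      using \<open>x \<in> V\<close> \<open>y \<in> V\<close> t[of b] unfolding P_def by blast+
    then show ?thesis using dist_triangle3[of x y "fst b"] by linarith
  qed
  moreover have "K - S \<subseteq> \<Union>W"
  proof
    fix z assume z: "z \<in> K - S"
    define \<sigma> where "\<sigma> = {b \<in> B. dist (fst b) z < t b}"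
    obtain b where b: "b \<in> B" "dist (fst b) z < snd b" using z B(3) by auto
    then have "b \<in> \<sigma>" using t[OF b(1)] by (simp add: \<sigma>_def)
    moreover have "z \<in> P \<sigma>"
    proof -
      have "dist (fst b) z \<noteq> t b" if "b \<in> B" for b using z that by (auto simp: S_def)
      then show ?thesis unfolding P_def \<sigma>_def by fastforce
    qed
    moreover have "\<sigma> \<subseteq> B" by (auto simp: \<sigma>_def)
    ultimately have "P \<sigma> \<in> W" "z \<in> P \<sigma>" unfolding W_def by auto
    then show "z \<in> \<Union>W" by (rule UnionI)
  qed
  ultimately have W: "finite W \<and> pairwise disjnt W \<and>
      (\<forall>V\<in>W. open V \<and> (\<forall>x\<in>V. \<forall>y\<in>V. dist x y < \<epsilon>))" "K - S \<subseteq> \<Union>W"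
    by auto
  show ?case
  proof (intro exI[of _ "U(n := W)"] conjI)
    show "\<forall>i<Suc n. finite ((U(n := W)) i) \<and> pairwise disjnt ((U(n := W)) i) \<and>
        (\<forall>V\<in>(U(n := W)) i. open V \<and> (\<forall>x\<in>V. \<forall>y\<in>V. dist x y < \<epsilon>))"
      using U(1) W(1) by (simp add: less_Suc_eq)
    have "(\<Union>i<Suc n. \<Union>((U(n := W)) i)) = (\<Union>i<n. \<Union>(U i)) \<union> \<Union>W"
      by (simp add: lessThan_Suc Un_commute)
    moreover have "K \<subseteq> S \<union> (K - S)" by auto
    then have "K \<subseteq> (\<Union>i<n. \<Union>(U i)) \<union> \<Union>W" using Un_mono[OF U(2) W(2)] by (rule subset_trans)
    ultimately show "K \<subseteq> (\<Union>i<Suc n. \<Union>((U(n := W)) i))" by (simp only:)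
  qed
qed

text \<open>
  The coloured cover in functional form: \<open>u i\<close> is the rescaled distance to the complement within
  \<open>X\<close> of the set of colour \<open>i\<close> in which the point lies, and \<open>q i\<close> picks a representative of that set. The
  inequality for points with different representatives expresses quantitatively that sets of
  the same colour are disjoint: leaving one of them costs at least the distance to its complement.
  The last property is the Lebesgue number of the cover.
\<close>

lemma colour_functions:
  fixes X :: "'a::metric_space set"
  assumes "compact X" "null_content n X" "\<epsilon> > 0"
  obtains u :: "nat \<Rightarrow> 'a \<Rightarrow> real" and q :: "nat \<Rightarrow> 'a \<Rightarrow> 'a" and K
  where "\<And>i. i < n \<Longrightarrow> K-lipschitz_on X (u i)"
    and "\<And>i. i < n \<Longrightarrow> finite (q i ` X)"
    and "\<And>i x. i < n \<Longrightarrow> x \<in> X \<Longrightarrow> q i x \<in> X"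
    and "\<And>i x. i < n \<Longrightarrow> x \<in> X \<Longrightarrow> 0 < u i x \<Longrightarrow> dist x (q i x) < \<epsilon>"
    and "\<And>i x y. i < n \<Longrightarrow> x \<in> X \<Longrightarrow> y \<in> X \<Longrightarrow> 0 < u i x \<Longrightarrow> 0 < u i y \<Longrightarrow>
           q i x \<noteq> q i y \<Longrightarrow> u i x \<le> K * dist x y"
    and "\<And>x. x \<in> X \<Longrightarrow> \<exists>i<n. 1 \<le> u i x"
proof -
  obtain U :: "nat \<Rightarrow> 'a set set" where U: "\<forall>i<n. finite (U i) \<and> pairwise disjnt (U i) \<and>
      (\<forall>V\<in>U i. open V \<and> (\<forall>x\<in>V. \<forall>y\<in>V. dist x y < \<epsilon>))" "X \<subseteq> (\<Union>i<n. \<Union>(U i))"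
    using coloured_cover[OF assms(2,3)] by (elim exE conjE) (rule that)
  have opn: "open V" if "V \<in> (\<Union>i<n. U i)" for V using U(1) that by blast
  have "X \<subseteq> \<Union>(\<Union>i<n. U i)" using U(2) by blast
  then obtain e where e: "e > 0" "\<And>x. x \<in> X \<Longrightarrow> \<exists>V\<in>(\<Union>i<n. U i). ball x e \<subseteq> V"
    using Heine_Borel_lemma[OF assms(1) _ opn] by metis
  define \<delta> where "\<delta> = min e 1"
  have \<delta>: "0 < \<delta>" "\<delta> \<le> e" "\<delta> \<le> 1" using e by (auto simp: \<delta>_def)
  \<comment> \<open>The distance to an empty set is \<open>0\<close> by convention, whereas a set that contains all of \<open>X\<close> needs
    a positive weight.\<close>
  define w where "w V x = (if X \<subseteq> V then 1 else infdist x (X - V))" for V x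
  have w0: "w V x \<ge> 0" for V x by (simp add: w_def infdist_nonneg)
  have w_lip: "\<bar>w V x - w V y\<bar> \<le> dist x y" for V x y
    by (simp add: w_def infdist_triangle_abs)
  have w_out: "w V x \<le> dist x y" if "y \<in> X" "y \<notin> V" for V x y
    using that by (auto simp: w_def intro!: infdist_le)
  have w_in: "\<delta> \<le> w V x" if "ball x e \<subseteq> V" "x \<in> X" for V x
  proof (cases "X \<subseteq> V")
    case False
    then have "e \<le> infdist x (X - V)"
      using that by (subst infdist_notempty) (force simp: subset_iff intro!: cINF_greatest)+
    then show ?thesis using False \<delta> by (simp add: w_def)
  qed (use \<delta> in \<open>auto simp: w_def\<close>)
  define V where "V i x = (SOME V. V \<in> U i \<and> x \<in> V)" for i x
  have V_eq: "V i x = V'" if "V' \<in> U i" "x \<in> V'" "i < n" for i x V'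
  proof -
    have "V i x \<in> U i \<and> x \<in> V i x" unfolding V_def by (rule someI) (use that in blast)
    then show ?thesis using U(1) that unfolding pairwise_def disjnt_iff by blast
  qed
  define v where "v i x = (if x \<in> \<Union>(U i) then w (V i x) x else 0)" for i x
  have v0: "v i x \<ge> 0" for i x by (simp add: v_def w0)
  have v_sep: "v i x \<le> dist x y" if "i < n" "y \<in> X" "\<not> (\<exists>V\<in>U i. x \<in> V \<and> y \<in> V)" for i x y
  proof (cases "x \<in> \<Union>(U i)")
    case True
    then obtain V' where V': "V' \<in> U i" "x \<in> V'" by blast
    then have "y \<notin> V'" using that by blast
    then show ?thesis using w_out[OF that(2), of V' x] V_eq[OF V' that(1)] True by (simp add: v_def)
  qed (simp add: v_def)
  have v_lip: "\<bar>v i x - v i y\<bar> \<le> dist x y" if "i < n" "x \<in> X" "y \<in> X" for i x y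
  proof (cases "\<exists>V\<in>U i. x \<in> V \<and> y \<in> V")
    case True
    then obtain V' where V': "V' \<in> U i" "x \<in> V'" "y \<in> V'" by blast
    then have "v i x = w V' x" "v i y = w V' y"
      using V_eq[OF V'(1,2) that(1)] V_eq[OF V'(1,3) that(1)] unfolding v_def by auto
    then show ?thesis using w_lip[of V' x y] by simp
  next
    case False
    then have "\<not> (\<exists>V\<in>U i. y \<in> V \<and> x \<in> V)" by blast
    from v_sep[OF that(1,2) this] show ?thesis
      using v_sep[OF that(1,3) False] v0[of i x] v0[of i y] dist_commute[of x y] by linarith
  qed
  define p where "p S = (SOME z. z \<in> X \<and> (X \<inter> S = {} \<or> z \<in> S))" for S
  have p: "p S \<in> X \<and> (X \<inter> S = {} \<or> p S \<in> S)" if "X \<noteq> {}" for S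
    unfolding p_def by (rule someI_ex) (use that in blast)
  define Q where "Q i x = (if x \<in> \<Union>(U i) then p (V i x) else p {})" for i x
  have Q_eq: "Q i x = p V'" if "V' \<in> U i" "x \<in> V'" "i < n" for i x V'
    using that V_eq[OF that] by (auto simp: Q_def)
  show thesis
  proof (rule that[of "1 / \<delta>" "\<lambda>i x. v i x / \<delta>" Q])
    show "(1 / \<delta>)-lipschitz_on X (\<lambda>x. v i x / \<delta>)" if "i < n" for i
      using v_lip[OF that] \<delta>
      by (intro lipschitz_onI) (auto simp: dist_real_def divide_right_mono simp flip: diff_divide_distrib)
    show "finite (Q i ` X)" if "i < n" for i
    proof (rule finite_subset)
      show "Q i ` X \<subseteq> insert (p {}) (p ` U i)"
      proof (rule image_subsetI)
        fix x assume "x \<in> X"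
        show "Q i x \<in> insert (p {}) (p ` U i)"
        proof (cases "x \<in> \<Union>(U i)")
          case True
          then obtain V' where "V' \<in> U i" "x \<in> V'" by blast
          then show ?thesis using Q_eq that by auto
        qed (simp add: Q_def)
      qed
      show "finite (insert (p {}) (p ` U i))" using U(1) that by simp
    qed
    show "Q i x \<in> X" if "i < n" "x \<in> X" for i x
      using p that by (auto simp: Q_def)
    show "dist x (Q i x) < \<epsilon>" if "i < n" "x \<in> X" "0 < v i x / \<delta>" for i x
    proof -
      have "x \<in> \<Union>(U i)" using that(3) by (auto simp: v_def split: if_splits)
      then obtain V' where V': "V' \<in> U i" "x \<in> V'" by blast
      then have "Q i x \<in> V'" using Q_eq[OF V' that(1)] p[of V'] that(2) by auto
      then show ?thesis using U(1) that(1) V' by blast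
    qed
    show "v i x / \<delta> \<le> 1 / \<delta> * dist x y"
      if "i < n" "x \<in> X" "y \<in> X" "0 < v i x / \<delta>" "0 < v i y / \<delta>" "Q i x \<noteq> Q i y" for i x y
    proof -
      have "\<not> (\<exists>V\<in>U i. x \<in> V \<and> y \<in> V)" using Q_eq that(1,6) by metis
      then show ?thesis using v_sep[OF that(1,3)] \<delta> by (simp add: divide_right_mono)
    qed
    show "\<exists>i<n. 1 \<le> v i x / \<delta>" if x: "x \<in> X" for x
    proof -
      obtain i V' where i: "i < n" "V' \<in> U i" "ball x e \<subseteq> V'" using e(2)[OF x] by blast
      then have "x \<in> V'" using e(1) by auto
      then have "v i x = w V' x" using V_eq[OF i(2) _ i(1)] i(2) by (auto simp: v_def)
      then show ?thesis using w_in[OF i(3) x] \<delta> i(1) by auto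
    qed
  qed
qed

section \<open>Gluing Lipschitz maps along contractions\<close>

lemma lipschitz_on_if_bounded_and_small_scale:
  fixes g :: "'a::metric_space \<Rightarrow> 'b::metric_space"
  assumes "bounded (g ` D)" "\<eta> > 0" "L \<ge> 0"
    and small: "\<And>x y. x \<in> D \<Longrightarrow> y \<in> D \<Longrightarrow> dist x y < \<eta> \<Longrightarrow> dist (g x) (g y) \<le> L * dist x y"
  shows "\<exists>L'. L'-lipschitz_on D g"
proof -
  obtain M where M: "M \<ge> 0" "\<And>x y. x \<in> D \<Longrightarrow> y \<in> D \<Longrightarrow> dist (g x) (g y) \<le> M"
    using diameter_bounded_bound[OF assms(1)] diameter_ge_0[OF assms(1)] by (metis imageI)
  have "(L + M / \<eta>)-lipschitz_on D g"
  proof (rule lipschitz_onI)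
    fix x y assume xy: "x \<in> D" "y \<in> D"
    show "dist (g x) (g y) \<le> (L + M / \<eta>) * dist x y"
    proof (cases "dist x y < \<eta>")
      case True
      have "0 \<le> M / \<eta> * dist x y" using M assms(2) by simp
      then show ?thesis using small[OF xy True] by (simp add: distrib_right)
    next
      case False
      then have "M \<le> M / \<eta> * dist x y"
        using M assms(2) by (simp add: field_simps mult_left_mono)
      moreover have "0 \<le> L * dist x y" using assms(3) by simp
      ultimately show ?thesis using M(2)[OF xy] by (simp add: distrib_right)
    qed
  qed (use M assms in auto)
  then show ?thesis by blast
qed

text \<open>
  The gluing step. Here \<open>g\<close> is defined where \<open>m \<ge> a\<close>, and \<open>u\<close> is the weight of the new colour. As \<open>m\<close>
  decreases from \<open>b\<close> to \<open>a\<close>, the value of \<open>g\<close> is moved along the contraction \<open>\<phi>\<close> from its original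
  place to the constant \<open>c\<close>, which then serves where \<open>g\<close> is undefined. The result is defined where
  \<open>max m u \<ge> b\<close>: if \<open>m < b\<close>, then \<open>u \<ge> b > 0\<close>, so a contraction is available. The price is
  that the domain of \<open>g\<close> shrinks from \<open>m \<ge> a\<close> to \<open>m \<ge> b\<close>. Since the result is bounded, the Lipschitz
  estimate matters only for points too close to lie in different sets of the new colour.
\<close>

lemma lipschitz_on_extend_by_contractions:
  fixes Z :: "'z::metric_space set" and g :: "'z \<Rightarrow> 'b::metric_space" and m u :: "'z \<Rightarrow> real"
    and a b :: real and q :: "'z \<Rightarrow> 'c" and \<phi> :: "'c \<Rightarrow> 'b \<times> real \<Rightarrow> 'b" and c :: "'c \<Rightarrow> 'b"
  defines "D \<equiv> {z \<in> Z. b \<le> max (m z) (u z)}"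
    and "g' \<equiv> \<lambda>z. if b \<le> m z then g z
             else if a \<le> m z then \<phi> (q z) (g z, (b - m z) / (b - a)) else c (q z)"
  assumes ab: "a < b" "0 < b"
    and m: "K-lipschitz_on Z m" and u: "K-lipschitz_on Z u"
    and sep: "\<And>z z'. z \<in> Z \<Longrightarrow> z' \<in> Z \<Longrightarrow> 0 < u z \<Longrightarrow> 0 < u z' \<Longrightarrow> q z \<noteq> q z' \<Longrightarrow>
               u z \<le> K * dist z z'"
    and g: "M-lipschitz_on {z \<in> Z. a \<le> m z} g"
    and \<phi>: "\<And>z. z \<in> Z \<Longrightarrow> 0 < u z \<Longrightarrow> L-lipschitz_on (B (q z) \<times> {0..1}) (\<phi> (q z))"
      "\<And>z y. z \<in> Z \<Longrightarrow> 0 < u z \<Longrightarrow> y \<in> B (q z) \<Longrightarrow> \<phi> (q z) (y, 0) = y"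
      "\<And>z y. z \<in> Z \<Longrightarrow> 0 < u z \<Longrightarrow> y \<in> B (q z) \<Longrightarrow> \<phi> (q z) (y, 1) = c (q z)"
    and B: "\<And>z. z \<in> Z \<Longrightarrow> 0 < u z \<Longrightarrow> a \<le> m z \<Longrightarrow> g z \<in> B (q z)"
    and bdd: "bounded (g' ` D)"
  shows "\<exists>L'. L'-lipschitz_on D (g')"
proof (cases "\<exists>z\<in>Z. 0 < u z")
  case False
  then have "D \<subseteq> {z \<in> Z. a \<le> m z}" "\<And>z. z \<in> D \<Longrightarrow> b \<le> m z"
    using ab by (auto simp: D_def le_max_iff_disj)
  then have "M-lipschitz_on D (g')"
    using g by (auto simp: lipschitz_on_def g'_def subset_iff)
  then show ?thesis by blast
next
  case True
  have K: "K \<ge> 0" and M: "M \<ge> 0" and L: "L \<ge> 0"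
    using m g \<phi>(1) True lipschitz_on_nonneg by blast+
  define \<tau> where "\<tau> z = max 0 ((b - m z) / (b - a))" for z
  define R where "R = K / (b - a)"
  have R: "R \<ge> 0" using K ab by (simp add: R_def)
  have m_diff: "\<bar>m z - m z'\<bar> \<le> K * dist z z'" "\<bar>u z - u z'\<bar> \<le> K * dist z z'"
    if "z \<in> Z" "z' \<in> Z" for z z'
    using lipschitz_onD[OF m that] lipschitz_onD[OF u that] by (auto simp: dist_real_def)
  have slope: "\<bar>(b - m z) / (b - a) - (b - m z') / (b - a)\<bar> \<le> R * dist z z'"
    if "z \<in> Z" "z' \<in> Z" for z z'
  proof -
    have "\<bar>(b - m z) / (b - a) - (b - m z') / (b - a)\<bar> = \<bar>m z - m z'\<bar> / (b - a)"
      using ab by (simp add: abs_minus_commute flip: diff_divide_distrib)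
    also have "\<dots> \<le> K * dist z z' / (b - a)"
      using m_diff[OF that] ab by (intro divide_right_mono) auto
    finally show ?thesis by (simp add: R_def)
  qed
  have dist_le: "dist (y, s) (y', s') \<le> dist y y' + \<bar>s - s'\<bar>" for y y' :: 'b and s s' :: real
    unfolding dist_prod_def using sqrt_sum_squares_le_sum_abs[of "dist y y'" "dist s s'"]
    by (simp add: dist_real_def)
  have form: "g' z = \<phi> (q z) (g z, \<tau> z)" "\<tau> z \<in> {0..1}" if "z \<in> Z" "0 < u z" "a \<le> m z" for z
    using that ab \<phi>(2)[OF that(1,2) B[OF that]] by (auto simp: g'_def \<tau>_def max_def field_simps)
  \<comment> \<open>Below this distance, \<open>m\<close> and \<open>u\<close> change by less than \<open>b\<close>, so two points of which one has
    \<open>u \<ge> b\<close> share the same value of \<open>q\<close>.\<close>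
  define \<eta> where "\<eta> = b / (K + 1)"
  have \<eta>: "\<eta> > 0" using ab K by (simp add: \<eta>_def)
  define C where "C = M + L * (M + R)"
  have MC: "M \<le> C" "L * (M + R) \<le> C" "L * R \<le> C" "0 \<le> C"
    using M L R by (auto simp: C_def distrib_left)
  have main: "dist (g' z) (g' z') \<le> C * dist z z'"
    if z: "z \<in> D" "z' \<in> D" "dist z z' < \<eta>" and le: "m z' \<le> m z" for z z'
  proof -
    have Z: "z \<in> Z" "z' \<in> Z" using z by (auto simp: D_def)
    have Kb: "K * dist z z' < b"
    proof -
      have "K * dist z z' \<le> (K + 1) * dist z z'" by (simp add: distrib_right)
      also have "\<dots> < b" using z(3) K by (simp add: \<eta>_def field_simps)
      finally show ?thesis .
    qed
    have up: "r * dist z z' \<le> C * dist z z'" if "r \<le> C" for r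
      using that by (rule mult_right_mono) simp
    show ?thesis
    proof (cases "b \<le> m z'")
      case True
      then have "dist (g' z) (g' z') \<le> M * dist z z'"
        using lipschitz_onD[OF g, of z z'] Z le ab by (simp add: g'_def)
      then show ?thesis using up[OF MC(1)] by linarith
    next
      case False
      then have uz': "b \<le> u z'" using z(2) by (auto simp: D_def le_max_iff_disj)
      then have uz: "0 < u z" using m_diff(2)[OF Z] Kb by linarith
      have u0: "0 < u z'" using uz' ab by linarith
      have q: "q z' = q z"
        using sep[OF Z(2,1) u0 uz] Kb uz' by (auto simp: dist_commute)
      show ?thesis
      proof (cases "a \<le> m z'")
        case True
        then have a: "a \<le> m z" using le by simp
        have "dist (g' z) (g' z') = dist (\<phi> (q z) (g z, \<tau> z)) (\<phi> (q z) (g z', \<tau> z'))"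
          using form(1)[OF Z(1) uz a] form(1)[OF Z(2) u0 True] q by simp
        also have "\<dots> \<le> L * dist (g z, \<tau> z) (g z', \<tau> z')"
          using form(2)[OF Z(1) uz a] form(2)[OF Z(2) u0 True] B[OF Z(1) uz a] B[OF Z(2) u0 True] q
          by (intro lipschitz_onD[OF \<phi>(1)[OF Z(1) uz]]) auto
        also have "\<dots> \<le> L * (M * dist z z' + R * dist z z')"
        proof -
          have "dist (g z) (g z') \<le> M * dist z z'"
            using lipschitz_onD[OF g, of z z'] Z a True by simp
          moreover have "\<bar>\<tau> z - \<tau> z'\<bar> \<le> R * dist z z'"
            using slope[OF Z] unfolding \<tau>_def by linarith
          ultimately have "dist (g z, \<tau> z) (g z', \<tau> z') \<le> M * dist z z' + R * dist z z'"
            using dist_le[of "g z" "\<tau> z" "g z'" "\<tau> z'"] by linarith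
          then show ?thesis using L by (rule mult_left_mono)
        qed
        finally have "dist (g' z) (g' z') \<le> (L * (M + R)) * dist z z'"
          by (simp add: algebra_simps)
        then show ?thesis using up[OF MC(2)] by linarith
      next
        case below: False
        show ?thesis
        proof (cases "a \<le> m z")
          case a: True
          have "dist (g' z) (g' z') = dist (\<phi> (q z) (g z, \<tau> z)) (\<phi> (q z) (g z, 1))"
            using form(1)[OF Z(1) uz a] \<phi>(3)[OF Z(1) uz B[OF Z(1) uz a]] below False q
            by (simp add: g'_def)
          also have "\<dots> \<le> L * dist (g z, \<tau> z) (g z, 1)"
            using form(2)[OF Z(1) uz a] B[OF Z(1) uz a]
            by (intro lipschitz_onD[OF \<phi>(1)[OF Z(1) uz]]) auto
          also have "\<dots> \<le> L * (R * dist z z')"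
          proof -
            have "1 < (b - m z') / (b - a)" using below ab by (simp add: field_simps)
            then have "\<bar>\<tau> z - 1\<bar> \<le> R * dist z z'"
              using slope[OF Z] form(2)[OF Z(1) uz a] unfolding \<tau>_def by auto
            then have "dist (g z, \<tau> z) (g z, 1) \<le> R * dist z z'"
              using dist_le[of "g z" "\<tau> z" "g z" 1] by simp
            then show ?thesis using L by (rule mult_left_mono)
          qed
          finally have "dist (g' z) (g' z') \<le> (L * R) * dist z z'"
            by (simp add: mult.assoc)
          then show ?thesis using up[OF MC(3)] by linarith
        next
          case below': False
          then have "g' z = g' z'" using below q ab by (simp add: g'_def)
          then show ?thesis using MC by simp
        qed
      qed
    qed
  qed
  show ?thesis
  proof (rule lipschitz_on_if_bounded_and_small_scale[OF bdd \<eta> MC(4)])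
    fix z z' assume *: "z \<in> D" "z' \<in> D" "dist z z' < \<eta>"
    show "dist (g' z) (g' z') \<le> C * dist z z'"
    proof (cases "m z' \<le> m z")
      case True then show ?thesis using main * by blast
    next
      case False
      then show ?thesis using main[of z' z] * by (simp add: dist_commute)
    qed
  qed
qed

section \<open>Uniform contractibility near compact sets\<close>

text \<open>
  In contrast to the definition of local Lipschitz contractibility, the ball may contract to a
  point \<open>c\<close> other than its centre. This makes the property uniform over compact sets of centres:
  a contraction for a ball also serves all smaller balls that it contains.
\<close>

definition lipschitz_contractible_within :: "'b::metric_space set \<Rightarrow> 'b \<Rightarrow> real \<Rightarrow> real \<Rightarrow> bool" where
  "lipschitz_contractible_within Y p r \<epsilon> \<longleftrightarrow>
     (\<exists>(\<phi> :: 'b \<times> real \<Rightarrow> 'b) L c.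
        L-lipschitz_on ((ball p r \<inter> Y) \<times> {0..1}) \<phi> \<and>
        \<phi> ` ((ball p r \<inter> Y) \<times> {0..1}) \<subseteq> ball p \<epsilon> \<inter> Y \<and> c \<in> ball p \<epsilon> \<inter> Y \<and>
        (\<forall>y\<in>ball p r \<inter> Y. \<phi> (y, 0) = y \<and> \<phi> (y, 1) = c))"

definition contraction_modulus :: "'b::metric_space set \<Rightarrow> 'b set \<Rightarrow> (real \<Rightarrow> real) \<Rightarrow> bool" where
  "contraction_modulus Y C \<rho> \<longleftrightarrow>
     (\<forall>\<epsilon>>0. 0 < \<rho> \<epsilon> \<and> \<rho> \<epsilon> \<le> \<epsilon> \<and> (\<forall>p\<in>C. lipschitz_contractible_within Y p (\<rho> \<epsilon>) \<epsilon>))"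

text \<open>
  Finitely many balls of half the radius of contractibility cover \<open>C\<close>. Every centre in \<open>C\<close> lies in one
  of them, so the smallest of these half radii works for all centres at once.
\<close>

lemma contraction_modulus_exists:
  fixes Y C :: "'b::metric_space set"
  assumes Y: "locally_lipschitz_contractible Y" and C: "compact C" "C \<subseteq> Y"
  obtains \<rho> where "contraction_modulus Y C \<rho>"
proof -
  have "\<exists>r. 0 < r \<and> r \<le> \<epsilon> \<and> (\<forall>p\<in>C. lipschitz_contractible_within Y p r \<epsilon>)"
    if \<epsilon>: "\<epsilon> > 0" for \<epsilon> :: real
  proof (cases "C = {}")
    case True
    then show ?thesis using \<epsilon> by auto
  next
    case False
    define good where "good p r \<longleftrightarrow> 0 < r \<and> r \<le> \<epsilon> / 2 \<and> (\<exists>(\<phi> :: 'b \<times> real \<Rightarrow> 'b) L.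
        L-lipschitz_on ((ball p r \<inter> Y) \<times> {0..1}) \<phi> \<and>
        \<phi> ` ((ball p r \<inter> Y) \<times> {0..1}) \<subseteq> ball p (\<epsilon> / 2) \<inter> Y \<and>
        (\<forall>y\<in>ball p r \<inter> Y. \<phi> (y, 0) = y \<and> \<phi> (y, 1) = p))" for p r
    have "\<exists>r. good p r" if "p \<in> C" for p
    proof -
      have "p \<in> Y" "\<epsilon> / 2 > 0" using that C \<epsilon> by auto
      then show ?thesis
        using Y unfolding locally_lipschitz_contractible_def good_def greaterThanAtMost_iff Bex_def
        by blast
    qed
    then obtain R where R: "\<And>p. p \<in> C \<Longrightarrow> good p (R p)" by metis
    have "C \<subseteq> (\<Union>p\<in>C. ball p (R p / 2))" using R by (force simp: good_def)
    then obtain F where F: "F \<subseteq> C" "finite F" "C \<subseteq> (\<Union>p\<in>F. ball p (R p / 2))"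
      by (rule compactE_image[OF C(1) open_ball])
    define r where "r = Min ((\<lambda>p. R p / 2) ` F)"
    have Fne: "F \<noteq> {}" using F(3) False by auto
    have r_le: "r \<le> R p / 2" if "p \<in> F" for p
      unfolding r_def using F(2) that by (intro Min_le) auto
    have r0: "0 < r"
      unfolding r_def using F(1,2) Fne R by (subst Min_gr_iff) (auto simp: good_def)
    obtain p0 where p0: "p0 \<in> F" using Fne by blast
    have "r \<le> \<epsilon>"
      using r_le[OF p0] R[of p0] p0 F(1) by (auto simp: good_def)
    moreover have "lipschitz_contractible_within Y p r \<epsilon>" if p: "p \<in> C" for p
    proof -
      obtain p' where p': "p' \<in> F" "dist p' p < R p' / 2" using F(3) p by auto
      then have "good p' (R p')" using F(1) R by blast
      then obtain \<phi> :: "'b \<times> real \<Rightarrow> 'b" and L where R': "0 < R p'" "R p' \<le> \<epsilon> / 2"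
        and \<phi>: "L-lipschitz_on ((ball p' (R p') \<inter> Y) \<times> {0..1}) \<phi>"
          "\<phi> ` ((ball p' (R p') \<inter> Y) \<times> {0..1}) \<subseteq> ball p' (\<epsilon> / 2) \<inter> Y"
          "\<forall>y\<in>ball p' (R p') \<inter> Y. \<phi> (y, 0) = y \<and> \<phi> (y, 1) = p'"
        unfolding good_def by (elim exE conjE) (rule that)
      have 1: "ball p r \<subseteq> ball p' (R p')"
      proof
        fix y assume "y \<in> ball p r"
        then show "y \<in> ball p' (R p')"
          using dist_triangle[of p' y p] r_le[OF p'(1)] p'(2) by simp
      qed
      have 2: "ball p' (\<epsilon> / 2) \<subseteq> ball p \<epsilon>"
      proof
        fix y assume "y \<in> ball p' (\<epsilon> / 2)"
        then show "y \<in> ball p \<epsilon>"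
          using dist_triangle[of p y p'] R' p'(2) by (simp add: dist_commute)
      qed
      have sub: "(ball p r \<inter> Y) \<times> {0..1::real} \<subseteq> (ball p' (R p') \<inter> Y) \<times> {0..1}" using 1 by auto
      have "p' \<in> ball p \<epsilon> \<inter> Y"
        using p' R' F(1) C(2) by (auto simp: dist_commute)
      moreover have "L-lipschitz_on ((ball p r \<inter> Y) \<times> {0..1}) \<phi>"
        using \<phi>(1) sub by (rule lipschitz_on_subset)
      moreover have "\<phi> ` ((ball p r \<inter> Y) \<times> {0..1}) \<subseteq> ball p \<epsilon> \<inter> Y"
        using image_mono[OF sub, of \<phi>] \<phi>(2) 2 by (meson Int_mono order_refl subset_trans)
      moreover have "\<forall>y\<in>ball p r \<inter> Y. \<phi> (y, 0) = y \<and> \<phi> (y, 1) = p'"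
        using \<phi>(3) 1 by (meson IntD1 IntD2 IntI subsetD)
      ultimately show ?thesis unfolding lipschitz_contractible_within_def by (intro exI conjI)
    qed
    ultimately show ?thesis using r0 by blast
  qed
  then show ?thesis using that unfolding contraction_modulus_def by metis
qed

section \<open>Extension over coloured pieces\<close>

text \<open>
  The precision needed before a repair in order to have precision \<open>\<epsilon>\<close> after it. The factors \<open>2\<close> leave
  room for passing from \<open>F z\<close> to the representative value \<open>q z\<close> before and after the contraction.
\<close>

definition step_tolerance :: "(real \<Rightarrow> real) \<Rightarrow> real \<Rightarrow> real" where
  "step_tolerance \<rho> \<epsilon> = \<rho> (\<epsilon> / 2) / 2"

lemma step_tolerance:
  assumes "contraction_modulus Y C \<rho>" "\<epsilon> > 0"
  shows "0 < step_tolerance \<rho> \<epsilon>" "step_tolerance \<rho> \<epsilon> \<le> \<epsilon> / 4"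
proof -
  have "\<epsilon> / 2 > 0" using assms(2) by simp
  then have "0 < \<rho> (\<epsilon> / 2)" "\<rho> (\<epsilon> / 2) \<le> \<epsilon> / 2"
    using assms(1) unfolding contraction_modulus_def by blast+
  then show "0 < step_tolerance \<rho> \<epsilon>" "step_tolerance \<rho> \<epsilon> \<le> \<epsilon> / 4"
    by (auto simp: step_tolerance_def)
qed

lemma step_tolerance_iterate:
  assumes "contraction_modulus Y C \<rho>" "\<epsilon> > 0"
  shows "0 < (step_tolerance \<rho> ^^ n) \<epsilon>" "(step_tolerance \<rho> ^^ n) \<epsilon> \<le> \<epsilon>"
proof (induction n)
  case (Suc n)
  { case 1 then show ?case using step_tolerance(1)[OF assms(1) Suc(1)] by simp }
  { case 2 then show ?case using step_tolerance(2)[OF assms(1) Suc(1)] Suc by simp }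
qed (use assms in auto)

text \<open>
  Here \<open>q z\<close> is a value that \<open>F\<close> nearly takes on the whole piece containing \<open>z\<close>. Thus
  \<open>g z\<close> lies within twice the tolerance of \<open>q z\<close>, and the contraction of that ball is the one to use
  on the piece. There are finitely many pieces, hence a common Lipschitz constant.
\<close>

lemma lipschitz_extend_one_colour:
  fixes Z :: "'z::metric_space set" and g F q :: "'z \<Rightarrow> 'b::metric_space" and m u :: "'z \<Rightarrow> real"
  assumes \<rho>: "contraction_modulus Y C \<rho>" and C: "bounded C" and \<epsilon>: "\<epsilon> > 0"
    and ab: "a < b" "0 < b"
    and m: "K-lipschitz_on Z m" and u: "K-lipschitz_on Z u"
    and sep: "\<And>z z'. z \<in> Z \<Longrightarrow> z' \<in> Z \<Longrightarrow> 0 < u z \<Longrightarrow> 0 < u z' \<Longrightarrow> q z \<noteq> q z' \<Longrightarrow>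
               u z \<le> K * dist z z'"
    and q: "finite (q ` Z)" "q ` Z \<subseteq> C"
    and F: "F ` Z \<subseteq> C" "\<And>z. z \<in> Z \<Longrightarrow> 0 < u z \<Longrightarrow> dist (F z) (q z) < step_tolerance \<rho> \<epsilon>"
    and g: "M-lipschitz_on {z \<in> Z. a \<le> m z} g"
      "\<And>z. z \<in> Z \<Longrightarrow> a \<le> m z \<Longrightarrow> g z \<in> Y \<and> dist (g z) (F z) < step_tolerance \<rho> \<epsilon>"
  shows "\<exists>g' M'. M'-lipschitz_on {z \<in> Z. b \<le> max (m z) (u z)} g' \<and>
      (\<forall>z\<in>Z. b \<le> max (m z) (u z) \<longrightarrow> g' z \<in> Y \<and> dist (g' z) (F z) < \<epsilon>) \<and>
      (\<forall>z\<in>Z. b \<le> m z \<longrightarrow> g' z = g z)"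
proof -
  define \<sigma> where "\<sigma> = step_tolerance \<rho> \<epsilon>"
  have \<sigma>: "0 < \<sigma>" "\<sigma> \<le> \<epsilon> / 4" "\<rho> (\<epsilon> / 2) = 2 * \<sigma>"
    using step_tolerance[OF \<rho> \<epsilon>] by (auto simp: \<sigma>_def step_tolerance_def)
  define B where "B p = ball p (2 * \<sigma>) \<inter> Y" for p
  have "\<epsilon> / 2 > 0" using \<epsilon> by simp
  then have "\<forall>p\<in>C. \<exists>(\<phi> :: 'b \<times> real \<Rightarrow> 'b) L c.
          L-lipschitz_on (B p \<times> {0..1}) \<phi> \<and>
          \<phi> ` (B p \<times> {0..1}) \<subseteq> ball p (\<epsilon> / 2) \<inter> Y \<and> c \<in> ball p (\<epsilon> / 2) \<inter> Y \<and>
          (\<forall>y\<in>B p. \<phi> (y, 0) = y \<and> \<phi> (y, 1) = c)"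
    using \<rho> unfolding contraction_modulus_def lipschitz_contractible_within_def B_def \<sigma>(3)[symmetric]
    by blast
  then obtain \<phi> :: "'b \<Rightarrow> 'b \<times> real \<Rightarrow> 'b" and L c where \<phi>: "\<And>p. p \<in> C \<Longrightarrow>
          (L p)-lipschitz_on (B p \<times> {0..1}) (\<phi> p) \<and>
          \<phi> p ` (B p \<times> {0..1}) \<subseteq> ball p (\<epsilon> / 2) \<inter> Y \<and> c p \<in> ball p (\<epsilon> / 2) \<inter> Y \<and>
          (\<forall>y\<in>B p. \<phi> p (y, 0) = y \<and> \<phi> p (y, 1) = c p)"
    by metis
  obtain L0 where L0: "\<And>z. z \<in> Z \<Longrightarrow> L (q z) \<le> L0"
    using bdd_above_finite[OF finite_imageI[OF q(1), of L]] by (auto simp: bdd_above_def)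
  define g' where "g' z = (if b \<le> m z then g z
      else if a \<le> m z then \<phi> (q z) (g z, (b - m z) / (b - a)) else c (q z))" for z
  have qC: "q z \<in> C" if "z \<in> Z" for z using q(2) that by blast
  have gB: "g z \<in> B (q z)" if "z \<in> Z" "0 < u z" "a \<le> m z" for z
    using g(2)[OF that(1,3)] F(2)[OF that(1,2)] dist_triangle[of "q z" "g z" "F z"]
    by (simp add: B_def \<sigma>_def[symmetric] dist_commute)
  have close: "g' z \<in> Y \<and> dist (g' z) (F z) < \<epsilon>" if z: "z \<in> Z" "b \<le> max (m z) (u z)" for z
  proof (cases "b \<le> m z")
    case True
    then show ?thesis using g(2)[OF z(1)] ab \<sigma>(2) \<epsilon> by (auto simp: g'_def \<sigma>_def[symmetric])
  next
    case False
    then have uz: "0 < u z" using z(2) ab by (auto simp: le_max_iff_disj)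
    have "g' z \<in> ball (q z) (\<epsilon> / 2) \<inter> Y"
    proof (cases "a \<le> m z")
      case True
      have "(b - m z) / (b - a) \<in> {0..1}" using False True ab by auto
      then have "(g z, (b - m z) / (b - a)) \<in> B (q z) \<times> {0..1}" using gB[OF z(1) uz True] by blast
      then have "\<phi> (q z) (g z, (b - m z) / (b - a)) \<in> ball (q z) (\<epsilon> / 2) \<inter> Y"
        using \<phi>[OF qC[OF z(1)]] by (meson image_eqI subsetD)
      then show ?thesis using False True by (simp add: g'_def)
    next
      case below: False
      then show ?thesis using \<phi>[OF qC[OF z(1)]] False unfolding g'_def by simp
    qed
    then show ?thesis
      using F(2)[OF z(1) uz] dist_triangle[of "g' z" "F z" "q z"] \<sigma>(2) \<epsilon>
      by (simp add: \<sigma>_def[symmetric] dist_commute)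
  qed
  have "bounded (g' ` {z \<in> Z. b \<le> max (m z) (u z)})"
  proof -
    obtain x0 e where e: "\<And>y. y \<in> C \<Longrightarrow> dist x0 y \<le> e" using C by (auto simp: bounded_def)
    have "dist x0 (g' z) \<le> e + \<epsilon>" if "z \<in> Z" "b \<le> max (m z) (u z)" for z
      using close[OF that] e[of "F z"] F(1) that(1) dist_triangle[of x0 "g' z" "F z"]
      by (auto simp: dist_commute)
    then show ?thesis by (auto simp: bounded_def)
  qed
  then have "\<exists>M'. M'-lipschitz_on {z \<in> Z. b \<le> max (m z) (u z)} g'"
    unfolding g'_def
  proof (rule lipschitz_on_extend_by_contractions[OF ab m u sep g(1), rotated -1])
    fix z y assume z: "z \<in> Z" "0 < u z"
    show "L0-lipschitz_on (B (q z) \<times> {0..1}) (\<phi> (q z))"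
      using \<phi>[OF qC[OF z(1)]] L0[OF z(1)] by (auto intro: lipschitz_on_le)
    show "\<phi> (q z) (y, 0) = y" "\<phi> (q z) (y, 1) = c (q z)" if "y \<in> B (q z)"
      using \<phi>[OF qC[OF z(1)]] that by auto
    show "g z \<in> B (q z)" if "a \<le> m z" using gB z that by blast
  qed
  then show ?thesis using close by (auto simp: g'_def intro!: exI[of _ g'])
qed

text \<open>
  The sets \<open>{z. b \<le> running_max m u n z}\<close> are the domains reached after \<open>n\<close> colours.
\<close>

fun running_max :: "('z \<Rightarrow> real) \<Rightarrow> (nat \<Rightarrow> 'z \<Rightarrow> real) \<Rightarrow> nat \<Rightarrow> 'z \<Rightarrow> real" where
  "running_max m u 0 z = m z"
| "running_max m u (Suc n) z = max (running_max m u n z) (u n z)"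

lemma running_max_ge: "i < n \<Longrightarrow> u i z \<le> running_max m u n z" "m z \<le> running_max m u n z"
  by (induction n) (auto simp: less_Suc_eq)

lemma lipschitz_on_running_max:
  assumes "K-lipschitz_on Z m" "\<And>i. i < n \<Longrightarrow> K-lipschitz_on Z (u i)"
  shows "K-lipschitz_on Z (running_max m u n)"
  using assms(2)
proof (induction n)
  case 0
  then show ?case using assms(1) by simp
next
  case (Suc n)
  have 1: "K-lipschitz_on Z (running_max m u n)" "K-lipschitz_on Z (u n)" using Suc by auto
  show ?case
  proof (rule lipschitz_onI)
    fix x y assume xy: "x \<in> Z" "y \<in> Z"
    show "dist (running_max m u (Suc n) x) (running_max m u (Suc n) y) \<le> K * dist x y"
      using lipschitz_onD[OF 1(1) xy] lipschitz_onD[OF 1(2) xy]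
      by (auto simp: dist_real_def max_def)
  qed (use 1 lipschitz_on_nonneg in blast)
qed

text \<open>
  The extension theorem: one colour after the other, with tolerances that grow from stage to
  stage and domains given by increasing thresholds between \<open>a\<close> and \<open>b\<close>. The required
  initial precision depends on \<open>\<rho>\<close>, \<open>n\<close> and \<open>\<epsilon>\<close> but not on the domain, so it can be fixed before
  the domain and the colours are chosen.
\<close>

lemma lipschitz_extend_colours:
  fixes Z :: "'z::metric_space set" and g F :: "'z \<Rightarrow> 'b::metric_space" and q :: "nat \<Rightarrow> 'z \<Rightarrow> 'b"
    and m :: "'z \<Rightarrow> real" and u :: "nat \<Rightarrow> 'z \<Rightarrow> real"
  assumes \<rho>: "contraction_modulus Y C \<rho>" and C: "bounded C" and \<epsilon>: "\<epsilon> > 0"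
    and ab: "0 < a" "a < b"
    and m: "K-lipschitz_on Z m" and u: "\<And>i. i < n \<Longrightarrow> K-lipschitz_on Z (u i)"
    and sep: "\<And>i z z'. i < n \<Longrightarrow> z \<in> Z \<Longrightarrow> z' \<in> Z \<Longrightarrow> 0 < u i z \<Longrightarrow> 0 < u i z' \<Longrightarrow>
               q i z \<noteq> q i z' \<Longrightarrow> u i z \<le> K * dist z z'"
    and q: "\<And>i. i < n \<Longrightarrow> finite (q i ` Z)" "\<And>i. i < n \<Longrightarrow> q i ` Z \<subseteq> C"
    and F: "F ` Z \<subseteq> C"
      "\<And>i z. i < n \<Longrightarrow> z \<in> Z \<Longrightarrow> 0 < u i z \<Longrightarrow> dist (F z) (q i z) < (step_tolerance \<rho> ^^ n) \<epsilon>"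
    and g: "M-lipschitz_on {z \<in> Z. a \<le> m z} g"
      "\<And>z. z \<in> Z \<Longrightarrow> a \<le> m z \<Longrightarrow> g z \<in> Y \<and> dist (g z) (F z) < (step_tolerance \<rho> ^^ n) \<epsilon>"
  shows "\<exists>g' M'. M'-lipschitz_on {z \<in> Z. b \<le> running_max m u n z} g' \<and>
      (\<forall>z\<in>Z. b \<le> running_max m u n z \<longrightarrow> g' z \<in> Y \<and> dist (g' z) (F z) < \<epsilon>) \<and>
      (\<forall>z\<in>Z. b \<le> m z \<longrightarrow> g' z = g z)"
  using \<epsilon> ab u sep q F(2) g
proof (induction n arbitrary: b \<epsilon>)
  case 0
  have "{z \<in> Z. b \<le> m z} \<subseteq> {z \<in> Z. a \<le> m z}" using 0(3) by auto
  then have "M-lipschitz_on {z \<in> Z. b \<le> m z} g" using 0(9) by (rule lipschitz_on_subset[rotated])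
  then show ?case using 0(3,10) by (intro exI[of _ g] exI[of _ M]) auto
next
  case (Suc n)
  define h where "h = (a + b) / 2"
  have h: "a < h" "h < b" "0 < b" using Suc.prems(2,3) by (auto simp: h_def)
  define \<delta> where "\<delta> = step_tolerance \<rho> \<epsilon>"
  have \<delta>: "\<delta> > 0" using step_tolerance[OF \<rho> Suc.prems(1)] by (simp add: \<delta>_def)
  have tol: "(step_tolerance \<rho> ^^ Suc n) \<epsilon> = (step_tolerance \<rho> ^^ n) \<delta>"
    by (simp only: funpow_Suc_right \<delta>_def comp_apply)
  have "\<exists>g' M'. M'-lipschitz_on {z \<in> Z. h \<le> running_max m u n z} g' \<and>
      (\<forall>z\<in>Z. h \<le> running_max m u n z \<longrightarrow> g' z \<in> Y \<and> dist (g' z) (F z) < \<delta>) \<and>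
      (\<forall>z\<in>Z. h \<le> m z \<longrightarrow> g' z = g z)"
    using Suc.prems h \<delta> unfolding tol by (intro Suc.IH) auto
  then obtain g1 M1 where g1: "M1-lipschitz_on {z \<in> Z. h \<le> running_max m u n z} g1"
      "\<And>z. z \<in> Z \<Longrightarrow> h \<le> running_max m u n z \<Longrightarrow> g1 z \<in> Y \<and> dist (g1 z) (F z) < \<delta>"
      "\<And>z. z \<in> Z \<Longrightarrow> h \<le> m z \<Longrightarrow> g1 z = g z"
    by blast
  have le: "(step_tolerance \<rho> ^^ Suc n) \<epsilon> \<le> \<delta>"
    unfolding tol using step_tolerance_iterate(2)[OF \<rho> \<delta>] .
  have "\<exists>g' M'. M'-lipschitz_on {z \<in> Z. b \<le> max (running_max m u n z) (u n z)} g' \<and>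
      (\<forall>z\<in>Z. b \<le> max (running_max m u n z) (u n z) \<longrightarrow> g' z \<in> Y \<and> dist (g' z) (F z) < \<epsilon>) \<and>
      (\<forall>z\<in>Z. b \<le> running_max m u n z \<longrightarrow> g' z = g1 z)"
  proof (rule lipschitz_extend_one_colour[OF \<rho> C Suc.prems(1) h(2,3) _ _ _ _ _ F(1) _ g1(1)])
    show "K-lipschitz_on Z (running_max m u n)"
      using m Suc.prems(4) by (intro lipschitz_on_running_max) auto
    show "dist (F z) (q n z) < step_tolerance \<rho> \<epsilon>" if "z \<in> Z" "0 < u n z" for z
      using Suc.prems(8)[of n z] that le unfolding \<delta>_def by simp
    show "g1 z \<in> Y \<and> dist (g1 z) (F z) < step_tolerance \<rho> \<epsilon>"
      if "z \<in> Z" "h \<le> running_max m u n z" for z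
      using g1(2)[OF that] unfolding \<delta>_def .
  qed (use Suc.prems(4-7) in auto)
  then obtain g2 M2 where g2: "M2-lipschitz_on {z \<in> Z. b \<le> running_max m u (Suc n) z} g2"
      "\<And>z. z \<in> Z \<Longrightarrow> b \<le> running_max m u (Suc n) z \<Longrightarrow> g2 z \<in> Y \<and> dist (g2 z) (F z) < \<epsilon>"
      "\<And>z. z \<in> Z \<Longrightarrow> b \<le> running_max m u n z \<Longrightarrow> g2 z = g1 z"
    by auto
  have "g2 z = g z" if "z \<in> Z" "b \<le> m z" for z
    using g2(3)[OF that(1)] g1(3)[OF that(1)] running_max_ge(2)[of m z u n] that(2) h by simp
  then show ?case using g2 by blast
qed

section \<open>Lipschitz maps in homotopy classes\<close>

text \<open>
  The extension theorem is used twice. The map \<open>g\<close> arises from \<open>m = 0\<close>, for which nothing is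
  prescribed. The homotopy arises on the graph of \<open>f\<close> times the unit interval from a function \<open>m\<close>
  that reaches \<open>1\<close> exactly at the two ends. The tolerances are chosen backwards: \<open>\<epsilon>\<close> is the
  closeness of \<open>g\<close> to \<open>f\<close> required by the second use, and \<open>\<omega>\<close> the oscillation of \<open>f\<close> on the pieces
  required by the first.
\<close>

lemma homotopic_to_lipschitz_if_null_content:
  fixes X :: "'a::metric_space set" and Y :: "'b::metric_space set" and f :: "'a \<Rightarrow> 'b"
  assumes X: "compact X" and n: "null_content n X"
    and Y: "locally_lipschitz_contractible Y"
    and f: "continuous_on X f" "f ` X \<subseteq> Y"
  shows "\<exists>g L. L-lipschitz_on X g \<and> homotopic_with_canon (\<lambda>_. True) X Y f g"
proof (cases "X = {}")
  case True
  then have "0-lipschitz_on X f" "homotopic_with_canon (\<lambda>_. True) X Y f f"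
    by (auto intro: homotopic_with_canon_on_empty)
  then show ?thesis by blast
next
  case False
  define C where "C = f ` X"
  have C: "compact C" "C \<subseteq> Y" "bounded C"
    using compact_continuous_image[OF f(1) X] f(2) compact_imp_bounded by (auto simp: C_def)
  obtain \<rho> where \<rho>: "contraction_modulus Y C \<rho>"
    using contraction_modulus_exists[OF Y C(1,2)] .
  define \<epsilon> where "\<epsilon> = (step_tolerance \<rho> ^^ n) 1"
  define \<omega> where "\<omega> = (step_tolerance \<rho> ^^ n) \<epsilon>"
  have \<epsilon>: "\<epsilon> > 0" unfolding \<epsilon>_def using step_tolerance_iterate(1)[OF \<rho> zero_less_one] .
  have \<omega>: "\<omega> > 0" "\<omega> \<le> \<epsilon>" unfolding \<omega>_def using step_tolerance_iterate[OF \<rho> \<epsilon>] by auto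
  have "uniformly_continuous_on X f"
    using compact_uniformly_continuous X f(1) by blast
  then obtain \<delta> where \<delta>: "\<delta> > 0"
    "\<And>x y. x \<in> X \<Longrightarrow> y \<in> X \<Longrightarrow> dist x y < \<delta> \<Longrightarrow> dist (f x) (f y) < \<omega>"
    unfolding uniformly_continuous_on_def using \<omega>(1) by metis
  obtain u :: "nat \<Rightarrow> 'a \<Rightarrow> real" and q :: "nat \<Rightarrow> 'a \<Rightarrow> 'a" and K where
    u: "\<And>i. i < n \<Longrightarrow> K-lipschitz_on X (u i)" and
    q: "\<And>i. i < n \<Longrightarrow> finite (q i ` X)" "\<And>i x. i < n \<Longrightarrow> x \<in> X \<Longrightarrow> q i x \<in> X"
      "\<And>i x. i < n \<Longrightarrow> x \<in> X \<Longrightarrow> 0 < u i x \<Longrightarrow> dist x (q i x) < \<delta>" and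
    sep: "\<And>i x y. i < n \<Longrightarrow> x \<in> X \<Longrightarrow> y \<in> X \<Longrightarrow> 0 < u i x \<Longrightarrow> 0 < u i y \<Longrightarrow>
           q i x \<noteq> q i y \<Longrightarrow> u i x \<le> K * dist x y" and
    ge1: "\<And>x. x \<in> X \<Longrightarrow> \<exists>i<n. 1 \<le> u i x"
    by (rule colour_functions[OF X n \<delta>(1)]) (rule that)
  obtain x0 where "x0 \<in> X" using False by blast
  then have K: "K \<ge> 0" using ge1 u lipschitz_on_nonneg by blast
  have fq: "dist (f x) (f (q i x)) < \<omega>" if "i < n" "x \<in> X" "0 < u i x" for i x
    using \<delta>(2) q(2,3) that by blast
  have full: "1 \<le> running_max m (\<lambda>i z. u i (p z)) n z" if "p z \<in> X" for m z and p :: "'z \<Rightarrow> 'a"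
    using ge1[OF that] running_max_ge(1)[of _ n "\<lambda>i z. u i (p z)" z m] by (metis order_trans)
  have "\<exists>g M. M-lipschitz_on {x \<in> X. 1 \<le> running_max (\<lambda>_. 0) u n x} g \<and>
      (\<forall>x\<in>X. 1 \<le> running_max (\<lambda>_. 0) u n x \<longrightarrow> g x \<in> Y \<and> dist (g x) (f x) < \<epsilon>) \<and>
      (\<forall>x\<in>X. 1 \<le> (0::real) \<longrightarrow> g x = f x)"
  proof (rule lipschitz_extend_colours[where a = "1/2" and M = 0, OF \<rho> C(3) \<epsilon>])
    show "K-lipschitz_on X (\<lambda>_. 0::real)" using K by (auto simp: lipschitz_on_def)
    show "finite ((\<lambda>x. f (q i x)) ` X)" if "i < n" for i
      using finite_imageI[OF q(1)[OF that], of f] by (simp add: image_image)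
    show "dist (f x) (f (q i x)) < (step_tolerance \<rho> ^^ n) \<epsilon>"
      if "i < n" "x \<in> X" "0 < u i x" for i x
      using fq[OF that] unfolding \<omega>_def .
    show "u i x \<le> K * dist x y" if "i < n" "x \<in> X" "y \<in> X" "0 < u i x" "0 < u i y"
        "f (q i x) \<noteq> f (q i y)" for i x y
      using sep that by metis
  qed (use u q(2) in \<open>auto simp: C_def\<close>)
  moreover have "{x \<in> X. 1 \<le> running_max (\<lambda>_. 0) u n x} = X"
    using full[of id _ "\<lambda>_. 0"] by auto
  ultimately obtain g M where g: "M-lipschitz_on X g"
    "\<And>x. x \<in> X \<Longrightarrow> g x \<in> Y" "\<And>x. x \<in> X \<Longrightarrow> dist (g x) (f x) < \<epsilon>"
    by auto
  \<comment> \<open>On \<open>Z\<close> the map \<open>f\<close> is the second coordinate, hence Lipschitz. The set where \<open>m \<ge> 1/2\<close> consists of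
    two slabs at distance at least \<open>2/3\<close>, so that \<open>f\<close> and \<open>g\<close> on them form one Lipschitz map.\<close>
  define Z where "Z = (\<lambda>x. (x, f x)) ` X \<times> {0..1::real}"
  define m where "m z = max (1 - 3 * snd z) (3 * snd z - 2)" for z :: "('a \<times> 'b) \<times> real"
  define g0 where "g0 z = (if snd z < 1/2 then snd (fst z) else g (fst (fst z)))"
    for z :: "('a \<times> 'b) \<times> real"
  define K' where "K' = max K 3"
  have ZX: "fst (fst z) \<in> X" "snd (fst z) = f (fst (fst z))" if "z \<in> Z" for z
    using that by (auto simp: Z_def)
  have d1: "dist (fst (fst z)) (fst (fst z')) \<le> dist z z'" "dist (snd (fst z)) (snd (fst z')) \<le> dist z z'"
    "dist (snd z) (snd z') \<le> dist z z'" for z z' :: "('a \<times> 'b) \<times> real"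
    by (meson dist_fst_le dist_snd_le order_trans)+
  have K'_up: "r * dist (fst (fst z)) (fst (fst z')) \<le> s * dist z z'" if "r \<le> s" "0 \<le> s"
    for r s and z z' :: "('a \<times> 'b) \<times> real"
    using mult_mono[OF that(1) d1(1) that(2), of z z'] by simp
  have "\<exists>M'. M'-lipschitz_on {z \<in> Z. 1/2 \<le> m z} g0"
  proof (rule lipschitz_on_if_bounded_and_small_scale[of _ _ "1/2" "max 1 M"])
    have "compact (g ` X)"
      by (rule compact_continuous_image[OF lipschitz_on_continuous_on[OF g(1)] X])
    then have "bounded (C \<union> g ` X)" using C(3) compact_imp_bounded by (simp add: bounded_Un)
    moreover have "g0 ` {z \<in> Z. 1/2 \<le> m z} \<subseteq> C \<union> g ` X"
      using ZX by (auto simp: g0_def C_def)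
    ultimately show "bounded (g0 ` {z \<in> Z. 1/2 \<le> m z})" by (rule bounded_subset)
    fix z z' assume z: "z \<in> {z \<in> Z. 1/2 \<le> m z}" "z' \<in> {z \<in> Z. 1/2 \<le> m z}" "dist z z' < 1/2"
    have side: "snd z \<le> 1/6 \<or> 5/6 \<le> snd z" "snd z' \<le> 1/6 \<or> 5/6 \<le> snd z'"
      using z(1,2) by (auto simp: m_def le_max_iff_disj)
    have near: "\<bar>snd z - snd z'\<bar> < 1/2"
      using d1(3)[of z z'] z(3) unfolding dist_real_def by linarith
    show "dist (g0 z) (g0 z') \<le> max 1 M * dist z z'"
    proof (cases "snd z < 1/2")
      case True
      then have "snd z' < 1/2" using side near by auto
      then have "dist (g0 z) (g0 z') \<le> 1 * dist z z'" using True d1(2)[of z z'] by (simp add: g0_def)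
      also have "\<dots> \<le> max 1 M * dist z z'" by (intro mult_right_mono) auto
      finally show ?thesis .
    next
      case False
      then have "\<not> snd z' < 1/2" using side near by auto
      then have "dist (g0 z) (g0 z') \<le> M * dist (fst (fst z)) (fst (fst z'))"
        using False lipschitz_onD[OF g(1), of "fst (fst z)" "fst (fst z')"] z(1,2) ZX(1)
        by (simp add: g0_def)
      also have "\<dots> \<le> max 1 M * dist z z'" by (rule K'_up) auto
      finally show ?thesis .
    qed
  qed auto
  then obtain M0 where g0: "M0-lipschitz_on {z \<in> Z. 1/2 \<le> m z} g0" by blast
  have "\<exists>H M. M-lipschitz_on {z \<in> Z. 1 \<le> running_max m (\<lambda>i z. u i (fst (fst z))) n z} H \<and>
      (\<forall>z\<in>Z. 1 \<le> running_max m (\<lambda>i z. u i (fst (fst z))) n z \<longrightarrow>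
         H z \<in> Y \<and> dist (H z) (snd (fst z)) < 1) \<and>
      (\<forall>z\<in>Z. 1 \<le> m z \<longrightarrow> H z = g0 z)"
  proof (rule lipschitz_extend_colours[OF \<rho> C(3) zero_less_one _ _ _ _ _ _ _ _ _ g0])
    show "K'-lipschitz_on Z m"
    proof (rule lipschitz_onI)
      fix z z' assume "z \<in> Z" "z' \<in> Z"
      have "dist (m z) (m z') \<le> 3 * dist (snd z) (snd z')"
        by (auto simp: m_def dist_real_def max_def abs_if)
      also have "\<dots> \<le> K' * dist z z'"
        using d1(3)[of z z'] by (intro mult_mono) (auto simp: K'_def)
      finally show "dist (m z) (m z') \<le> K' * dist z z'" .
    qed (simp add: K'_def)
    show "K'-lipschitz_on Z (\<lambda>z. u i (fst (fst z)))" if "i < n" for i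
    proof (rule lipschitz_onI)
      fix z z' assume "z \<in> Z" "z' \<in> Z"
      then have "dist (u i (fst (fst z))) (u i (fst (fst z'))) \<le> K * dist (fst (fst z)) (fst (fst z'))"
        using ZX(1) by (intro lipschitz_onD[OF u[OF that]])
      also have "\<dots> \<le> K' * dist z z'" by (rule K'_up) (auto simp: K'_def)
      finally show "dist (u i (fst (fst z))) (u i (fst (fst z'))) \<le> K' * dist z z'" .
    qed (simp add: K'_def)
    show "u i (fst (fst z)) \<le> K' * dist z z'"
      if i: "i < n" and z: "z \<in> Z" "z' \<in> Z" "0 < u i (fst (fst z))" "0 < u i (fst (fst z'))"
        "f (q i (fst (fst z))) \<noteq> f (q i (fst (fst z')))" for i z z'
    proof -
      have "u i (fst (fst z)) \<le> K * dist (fst (fst z)) (fst (fst z'))"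
        using sep[OF i ZX(1)[OF z(1)] ZX(1)[OF z(2)] z(3,4)] z(5) by metis
      also have "\<dots> \<le> K' * dist z z'" by (rule K'_up) (auto simp: K'_def)
      finally show ?thesis .
    qed
    show "finite ((\<lambda>z. f (q i (fst (fst z)))) ` Z)" if "i < n" for i
    proof (rule finite_subset)
      show "(\<lambda>z. f (q i (fst (fst z)))) ` Z \<subseteq> f ` q i ` X" using ZX(1) by auto
      show "finite (f ` q i ` X)" using q(1)[OF that] by simp
    qed
    show "(\<lambda>z. f (q i (fst (fst z)))) ` Z \<subseteq> C" if "i < n" for i
      using q(2)[OF that] ZX(1) by (auto simp: C_def)
    show "(\<lambda>z. snd (fst z)) ` Z \<subseteq> C" using ZX by (auto simp: C_def)
    show "dist (snd (fst z)) (f (q i (fst (fst z)))) < (step_tolerance \<rho> ^^ n) 1"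
      if "i < n" "z \<in> Z" "0 < u i (fst (fst z))" for i z
      using fq[OF that(1) ZX(1)[OF that(2)] that(3)] \<omega>(2) ZX(2)[OF that(2)] unfolding \<epsilon>_def by simp
    show "g0 z \<in> Y \<and> dist (g0 z) (snd (fst z)) < (step_tolerance \<rho> ^^ n) 1" if "z \<in> Z" for z
      using ZX[OF that] g(2,3) C(2) \<epsilon> unfolding \<epsilon>_def[symmetric] by (auto simp: g0_def C_def)
  qed auto
  then obtain H L where H': "L-lipschitz_on {z \<in> Z. 1 \<le> running_max m (\<lambda>i z. u i (fst (fst z))) n z} H"
    "\<forall>z\<in>Z. 1 \<le> running_max m (\<lambda>i z. u i (fst (fst z))) n z \<longrightarrow>
       H z \<in> Y \<and> dist (H z) (snd (fst z)) < 1"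
    "\<forall>z\<in>Z. 1 \<le> m z \<longrightarrow> H z = g0 z"
    by (elim exE conjE) (rule that)
  have all: "1 \<le> running_max m (\<lambda>i z. u i (fst (fst z))) n z" if "z \<in> Z" for z
    using full[of "\<lambda>z. fst (fst z)" z m] ZX(1)[OF that] .
  then have "{z \<in> Z. 1 \<le> running_max m (\<lambda>i z. u i (fst (fst z))) n z} = Z" by blast
  then have H: "L-lipschitz_on Z H" "\<And>z. z \<in> Z \<Longrightarrow> H z \<in> Y"
    "\<And>z. z \<in> Z \<Longrightarrow> 1 \<le> m z \<Longrightarrow> H z = g0 z"
    using H' all by (simp, blast, blast)
  define h where "h p = H ((snd p, f (snd p)), fst p)" for p :: "real \<times> 'a"
  have Zp: "((x, f x), t) \<in> Z" if "x \<in> X" "t \<in> {0..1}" for x t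
    using that by (auto simp: Z_def)
  have "continuous_on ({0..1} \<times> X) h"
    unfolding h_def
  proof (rule continuous_on_compose2[OF lipschitz_on_continuous_on[OF H(1)]])
    show "continuous_on ({0..1} \<times> X) (\<lambda>p. ((snd p, f (snd p)), fst p))"
      by (intro continuous_intros continuous_on_compose2[OF f(1)]) auto
  qed (use Zp in auto)
  moreover have "h ` ({0..1} \<times> X) \<subseteq> Y" using H(2) Zp by (auto simp: h_def)
  moreover have "h (0, x) = f x" "h (1, x) = g x" if "x \<in> X" for x
    using H(3)[OF Zp[OF that]] by (auto simp: h_def m_def g0_def)
  ultimately have "homotopic_with_canon (\<lambda>_. True) X Y f g"
    by (subst homotopic_with) (auto intro!: exI[of _ h] simp: image_subset_iff)
  then show ?thesis using g(1) by blast
qed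

theorem corollary1p6:
  fixes X :: "'a::metric_space set" and Y :: "'b::metric_space set" and f :: "'a \<Rightarrow> 'b"
  assumes "alexandrov_space X"
    and "curvature_bounded_below X"
    and "compact X"
    and "hausdorff_dim X < \<infinity>"
    and "locally_lipschitz_contractible Y"
    and "continuous_on X f" and "f ` X \<subseteq> Y"
  shows "\<exists>g L. L-lipschitz_on X g \<and> homotopic_with_canon (\<lambda>_. True) X Y f g"
proof -
  obtain n where "null_content n X"
    using null_content_if_hausdorff_dim_finite[OF assms(3,4)] .
  then show ?thesis
    using homotopic_to_lipschitz_if_null_content assms(3,5,6,7) by blast
qed

end
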